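(* Let $c>1$ be a real number which is not an integer. Then for every multiplicative function $f:\mathbb N\to\mathbb C$ with $|f(n)|\le1$ for all $n$, and for every $\alpha\in\mathbb Q\setminus\mathbb Z$, \[\sum_{n<N}f(n)\,e\bigl(\alpha\lfloor n^c\rfloor\bigr)=o(N)\qquad(N\to\infty).\]
   Context: $e(u)=\exp(2\pi i u)$ for real $u$. *)

theory Defs
  imports "HOL-Analysis.Analysis"
begin

definition e :: "real \<Rightarrow> complex" where
  "e u = exp (2 * of_real pi * \<i> * of_real u)"

text \<open>Multiplicative arithmetic function on the positive integers (values at 0 are irrelevant).\<close>
definition multiplicative :: "(nat \<Rightarrow> complex) \<Rightarrow> bool" where
  "multiplicative f \<longleftrightarrow> f 1 = 1 \<and>
     (\<forall>m n. m > 0 \<longrightarrow> n > 0 \<longrightarrow> coprime m n \<longrightarrow> f (m * n) = f m * f n)"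

end

theory Submission
  imports Defs "HOL-Computational_Algebra.Squarefree"
begin

text \<open>
  Write \<open>a n = e (\<alpha> * \<lfloor>n powr c\<rfloor>)\<close>. By Katai's method (Turan--Kubilius and Cauchy--Schwarz)
  it suffices to control the correlations of \<open>a (p * n)\<close> and \<open>a (q * n)\<close> for primes
  \<open>p \<noteq> q\<close>. Up to \<open>\<epsilon>\<close> in mean, \<open>e (\<alpha> * \<lfloor>x\<rfloor>)\<close> is a trigonometric polynomial with
  finitely many nonzero frequencies \<open>\<mu>\<close>. Since \<open>e (\<theta> * n powr c)\<close> has mean zero for
  \<open>\<theta> \<noteq> 0\<close> (van der Corput differencing down to Fejer's theorem), the correlation is at most
  \<open>\<epsilon>\<close> unless \<open>(q / p) powr c\<close> is a quotient \<open>\<mu> / \<mu>'\<close> of two of these frequencies.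

  Whether such coincidences occur for irrational \<open>c\<close> is a question of transcendence theory
  (six exponentials), which is avoided as follows. For given \<open>\<epsilon>\<close> every prime \<open>p\<close> has a
  number of bad partners \<open>q\<close> bounded independently of \<open>p\<close>. Working in blocks of primes
  between \<open>4 ^ j\<close> and \<open>4 ^ (j + 1)\<close>, the bad pairs contribute a convergent geometric
  series, which is negligible because the sum of the reciprocals of the primes diverges.
\<close>

section \<open>Elementary properties of the additive character\<close>

lemma e_cis: "e x = cis (2 * pi * x)"
  by (simp add: e_def cis_conv_exp mult_ac)

lemma e_add: "e (x + y) = e x * e y"
  by (simp add: e_cis cis_mult ring_distribs)

lemma norm_e [simp]: "norm (e x) = 1"
  by (simp add: e_cis)

lemma e_0 [simp]: "e 0 = 1"
  by (simp add: e_cis)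

lemma cnj_e: "cnj (e x) = e (- x)"
  by (simp add: e_cis cis_cnj)

lemma e_minus_cnj: "e (x - y) = e x * cnj (e y)"
  by (simp add: cnj_e flip: e_add)

lemma e_of_int [simp]: "e (of_int k) = 1"
  by (simp add: e_cis cis_multiple_2pi)

text \<open>On the imaginary axis the exponential factor in the Taylor remainder equals
  \<open>1\<close>. This controls the error when a difference of phases is replaced by its linear
  part.\<close>

lemma norm_cis_taylor2: "norm (cis t - 1 - \<i> * of_real t) \<le> t\<^sup>2"
proof -
  have "norm (exp (\<i> * of_real t) - (\<Sum>k\<le>1. (\<i> * of_real t) ^ k / fact k)) \<le> exp \<bar>Re (\<i> * of_real t)\<bar>
      * (norm (\<i> * of_real t)) ^ Suc 1 / fact 1"
    by (rule Taylor_exp)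
  thus ?thesis by (simp add: cis_conv_exp power2_eq_square norm_mult diff_diff_eq)
qed

lemma norm_cis_minus_1: "norm (cis t - 1) = 2 * \<bar>sin (t / 2)\<bar>"
proof -
  have "(norm (cis t - 1))\<^sup>2 = (cos t - 1)\<^sup>2 + (sin t)\<^sup>2"
    by (simp add: cmod_power2)
  also have "\<dots> = 2 - 2 * cos t"
    using sin_cos_squared_add[of t] by (simp add: power2_eq_square algebra_simps)
  also have "\<dots> = (2 * \<bar>sin (t / 2)\<bar>)\<^sup>2"
    using cos_double_sin[of "t/2"] by (simp add: power_mult_distrib)
  finally show ?thesis by (subst (asm) power2_eq_iff_nonneg) auto
qed

lemma norm_e_minus_1: "norm (e x - 1) = 2 * \<bar>sin (x * pi)\<bar>"
  by (simp add: e_cis norm_cis_minus_1 mult_ac)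

lemma norm_e_diff_le: "norm (e x - e y) \<le> 2 * pi * \<bar>x - y\<bar>"
proof -
  have "e x - e y = (e (x - y) - 1) * e y"
    using e_add[of "x - y" y] by (simp add: algebra_simps)
  hence "norm (e x - e y) = norm (cis (2 * pi * (x - y)) - 1)"
    by (simp add: norm_mult e_cis)
  also have "\<dots> \<le> \<bar>2 * pi * (x - y)\<bar>" 
    using abs_sin_x_le_abs_x[of "2 * pi * (x - y) / 2"] by (simp add: norm_cis_minus_1)
  finally show ?thesis by (simp add: abs_mult)
qed

subsection \<open>Means and the van der Corput inequality\<close>

definition has_mean :: "(nat \<Rightarrow> complex) \<Rightarrow> complex \<Rightarrow> bool" where
  "has_mean z L \<longleftrightarrow> (\<lambda>N. (\<Sum>n<N. z n) / of_nat N) \<longlonglongrightarrow> L"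

lemma has_mean_add: "has_mean z L \<Longrightarrow> has_mean w K \<Longrightarrow> has_mean (\<lambda>n. z n + w n) (L + K)"
  unfolding has_mean_def by (drule (1) tendsto_add) (simp add: sum.distrib add_divide_distrib)

lemma has_mean_cmult: "has_mean z L \<Longrightarrow> has_mean (\<lambda>n. a * z n) (a * L)"
  unfolding has_mean_def by (drule tendsto_mult_left[where c = a]) (simp flip: sum_distrib_left)

lemma has_mean_minus: "has_mean z L \<Longrightarrow> has_mean (\<lambda>n. - z n) (- L)"
  using has_mean_cmult[of z L "-1"] by simp

lemma has_mean_diff: "has_mean z L \<Longrightarrow> has_mean w K \<Longrightarrow> has_mean (\<lambda>n. z n - w n) (L - K)"
  using has_mean_add[OF _ has_mean_minus] by simp

lemma has_mean_cnj: "has_mean z L \<Longrightarrow> has_mean (\<lambda>n. cnj (z n)) (cnj L)"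
  unfolding has_mean_def by (drule tendsto_cnj) (simp add: cnj_sum)

lemma has_mean_const: "has_mean (\<lambda>n. a) a"
proof -
  have "\<forall>\<^sub>F N in sequentially. (\<Sum>n<N. a) / of_nat N = a"
    using eventually_gt_at_top[of 0] by eventually_elim simp
  thus ?thesis unfolding has_mean_def by (rule tendsto_eventually)
qed

lemma has_mean_sum:
  assumes "\<And>i. i \<in> I \<Longrightarrow> has_mean (z i) (L i)"
  shows "has_mean (\<lambda>n. \<Sum>i\<in>I. z i n) (\<Sum>i\<in>I. L i)"
  using assms
proof (induction I rule: infinite_finite_induct)
  case (insert i I)
  thus ?case using has_mean_add[of "z i" "L i" "\<lambda>n. \<Sum>i\<in>I. z i n" "\<Sum>i\<in>I. L i"] by auto
qed (auto intro: has_mean_const)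

lemma sum_lessThan_add:
  fixes z :: "nat \<Rightarrow> 'a :: comm_monoid_add"
  shows "(\<Sum>n<a + b. z n) = (\<Sum>n<a. z n) + (\<Sum>n<b. z (n + a))"
  by (induction b) (simp_all add: add.assoc add.commute[of a])

text \<open>All but two boundary stretches of \<open>h\<close> terms each cancel, so the average is
  at most \<open>2 * h / N\<close>.\<close>

lemma has_mean_shift_aux:
  assumes bd: "\<And>n. norm (z n) \<le> 1"
  shows "has_mean (\<lambda>n. z (n + h) - z n) 0"
proof -
  have bnd: "norm ((\<Sum>n<N. z (n + h) - z n) / of_nat N) \<le> real (2 * h) / real N" for N
  proof -
    have "(\<Sum>n<N. z (n + h) - z n) = (\<Sum>n<h. z (n + N)) - (\<Sum>n<h. z n)"
    proof -
      have 1: "(\<Sum>n<h + N. z n) = (\<Sum>n<h. z n) + (\<Sum>n<N. z (n + h))"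
        by (rule sum_lessThan_add)
      have 2: "(\<Sum>n<N + h. z n) = (\<Sum>n<N. z n) + (\<Sum>n<h. z (n + N))"
        by (rule sum_lessThan_add)
      show ?thesis using 1 2 unfolding add.commute[of h N] sum_subtractf
        by algebra
    qed
    also have "norm \<dots> \<le> norm (\<Sum>n<h. z (n + N)) + norm (\<Sum>n<h. z n)"
      by (rule norm_triangle_ineq4)
    also have "\<dots> \<le> (\<Sum>n<h. 1) + (\<Sum>n<h. 1)"
      by (intro add_mono sum_norm_le bd)
    finally show ?thesis by (simp add: norm_divide divide_right_mono)
  qed
  have "(\<lambda>N. real (2 * h) / real N) \<longlonglongrightarrow> 0" by (rule lim_const_over_n)
  thus ?thesis unfolding has_mean_def
    by (rule Lim_null_comparison[rotated]) (use bnd in auto)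
qed

lemma has_mean_shift_iff:
  assumes bd: "\<And>n. norm (z n) \<le> 1"
  shows "has_mean (\<lambda>n. z (n + h)) L \<longleftrightarrow> has_mean z L"
  using has_mean_add[of z L "\<lambda>n. z (n + h) - z n" 0]
        has_mean_diff[of "\<lambda>n. z (n + h)" L "\<lambda>n. z (n + h) - z n" 0] has_mean_shift_aux[of z
            h, OF bd]
  by auto

lemma cesaro_null:
  fixes d :: "nat \<Rightarrow> real"
  assumes "d \<longlonglongrightarrow> 0"
  shows "(\<lambda>N. (\<Sum>n<N. \<bar>d n\<bar>) / real N) \<longlonglongrightarrow> 0"
proof (rule LIMSEQ_I)
  fix r :: real assume r: "r > 0"
  obtain m where m: "\<And>n. n \<ge> m \<Longrightarrow> \<bar>d n\<bar> < r / 2"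
    using LIMSEQ_D[OF assms, of "r/2"] r by auto
  define C where "C = (\<Sum>n<m. \<bar>d n\<bar>)"
  have C: "C \<ge> 0" unfolding C_def by (simp add: sum_nonneg)
  obtain k :: nat where k: "real k > 2 * C / r" using reals_Archimedean2 by blast
  have "\<bar>(\<Sum>n<N. \<bar>d n\<bar>) / real N\<bar> < r" if N: "N \<ge> max (Suc m) (Suc k)" for N
  proof -
    have "(\<Sum>n<N. \<bar>d n\<bar>) = C + (\<Sum>n=m..<N. \<bar>d n\<bar>)"
      unfolding C_def using N by (simp add: lessThan_atLeast0 sum.atLeastLessThan_concat)
    also have "(\<Sum>n=m..<N. \<bar>d n\<bar>) \<le> (\<Sum>n=m..<N. r / 2)"
      using m by (intro sum_mono less_imp_le) auto
    also have "\<dots> \<le> real N * (r / 2)" using r by (simp add: mult_right_mono)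
    also have "C < real N * (r / 2)"
    proof -
      have "2 * C / r < real N" using k N by linarith
      thus ?thesis using r by (simp add: field_simps)
    qed
    finally have "(\<Sum>n<N. \<bar>d n\<bar>) < real N * r" by (simp add: field_simps)
    moreover have "real N > 0" using N by simp
    ultimately show ?thesis using sum_nonneg[of "{..<N}" "\<lambda>n. \<bar>d n\<bar>"] by (simp add: field_simps)
  qed
  thus "\<exists>no. \<forall>n\<ge>no. norm ((\<Sum>n<n. \<bar>d n\<bar>) / real n - 0) < r" by auto
qed

lemma norm_mean_square_le:
  fixes z :: "nat \<Rightarrow> complex"
  shows
  "(norm ((\<Sum>n<N. z n) / of_nat N))\<^sup>2 \<le> (\<Sum>n<N. (norm (z n))\<^sup>2) / real N"
proof (cases "N = 0")
  case False
  have "norm (\<Sum>n<N. z n) \<le> (\<Sum>n<N. norm (z n))" by (rule norm_sum)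
  hence "(norm (\<Sum>n<N. z n))\<^sup>2 \<le> (\<Sum>n<N. 1 * norm (z n))\<^sup>2" by (intro power_mono) auto
  also have "\<dots> \<le> (\<Sum>n<N. 1\<^sup>2) * (\<Sum>n<N. (norm (z n))\<^sup>2)" by (rule Cauchy_Schwarz_ineq_sum)
  finally have "(norm (\<Sum>n<N. z n))\<^sup>2 \<le> real N * (\<Sum>n<N. (norm (z n))\<^sup>2)" by simp
  hence "(norm (\<Sum>n<N. z n))\<^sup>2 / (real N)\<^sup>2 \<le> real N * (\<Sum>n<N. (norm (z n))\<^sup>2) / (real N)\<^sup>2"
    by (intro divide_right_mono) auto
  thus ?thesis using False by (simp add: norm_divide power_divide power2_eq_square[of "real N"])
qed simp

text \<open>Replacing \<open>z\<close> by its averages over windows of length \<open>H\<close> does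
  not change the mean. In the mean square of these averages the diagonal contributes at most
  \<open>1 / H\<close>, and the off-diagonal products are shifted correlations of mean zero; then
  \<open>H\<close> is taken large.\<close>

lemma van_der_Corput:
  assumes bd: "\<And>n. norm (z n) \<le> 1"
    and corr: "\<And>h. h > 0 \<Longrightarrow> has_mean (\<lambda>n. z (n + h) * cnj (z n)) 0"
  shows "has_mean z 0"
proof -
  \<comment> \<open>Shifting by the smaller of \<open>h\<close> and \<open>h'\<close> reduces to the
    assumed correlations; conjugation exchanges the two roles.\<close>
  have off: "has_mean (\<lambda>n. z (n + h) * cnj (z (n + h'))) 0" if "h \<noteq> h'" for h h'
  proof -
    have gt: "has_mean (\<lambda>n. z (n + h) * cnj (z (n + h'))) 0" if "h > h'" for h h'
    proof -
      let ?w = "\<lambda>n. z (n + (h - h')) * cnj (z n)"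
      have "norm (?w n) \<le> 1" for n by (simp add: norm_mult bd mult_le_one)
      hence "has_mean (\<lambda>n. ?w (n + h')) 0" using corr[of "h - h'"] that
          by (subst has_mean_shift_iff) auto
      thus ?thesis using that by (simp add: algebra_simps)
    qed
    show ?thesis
    proof (cases "h > h'")
      case False
      hence "has_mean (\<lambda>n. cnj (z (n + h') * cnj (z (n + h)))) (cnj 0)"
        using that by (intro has_mean_cnj gt) auto
      thus ?thesis by (simp add: mult.commute)
    qed (rule gt)
  qed
  show ?thesis unfolding has_mean_def
  proof (rule LIMSEQ_I)
    fix r :: real assume r: "r > 0"
    \<comment> \<open>The mean square will be bounded by \<open>2 / H\<close>: one
      \<open>1 / H\<close> from the diagonal and one as tolerance for the off-diagonal mean. The
      bound \<open>8 / r^2\<close> makes this at most \<open>(r / 2)^2\<close>, leaving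
      \<open>r / 2\<close> for passing from \<open>w\<close> back to \<open>z\<close>.\<close>
    obtain H :: nat where H: "real H > max 1 (8 / r\<^sup>2)" using reals_Archimedean2 by blast
    have H0: "real H > 0" "H > 0" using H by auto
    have Hr: "2 / real H \<le> (r / 2)\<^sup>2"
      using H H0 r by (simp add: field_simps power2_eq_square)
    define w where "w = (\<lambda>n. (\<Sum>h<H. z (n + h)) / of_nat H)"
    have zw: "has_mean (\<lambda>n. w n - z n) 0"
    proof -
      have "has_mean (\<lambda>n. (1 / of_nat H) * (\<Sum>h<H. z (n + h) - z n)) ((1 / of_nat H) * (\<Sum>h<H. 0))"
        by (intro has_mean_cmult has_mean_sum has_mean_shift_aux bd)
      moreover have "(\<lambda>n. (1 / of_nat H) * (\<Sum>h<H. z (n + h) - z n)) = (\<lambda>n. w n - z n)"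
        using H0 by (auto simp: w_def sum_subtractf field_simps)
      ultimately show ?thesis by simp
    qed
    have sq: "complex_of_real ((norm (w n))\<^sup>2) = (1 / of_nat H)\<^sup>2
        * (\<Sum>h<H. (\<Sum>h'\<in>{..<H}-{h}. z (n + h) * cnj (z (n + h')))
        + complex_of_real ((norm (z (n+h)))\<^sup>2))" for n
    proof -
      have "complex_of_real ((norm (w n))\<^sup>2) = w n * cnj (w n)" by (rule complex_norm_square)
      also have "\<dots> = (1 / of_nat H)\<^sup>2 * (\<Sum>h<H. \<Sum>h'<H. z (n + h) * cnj (z (n + h')))"
        by (simp add: w_def cnj_sum sum_product power2_eq_square)
      also have "(\<Sum>h<H. \<Sum>h'<H. z (n + h) * cnj (z (n + h')))
          = (\<Sum>h<H. (\<Sum>h'\<in>{..<H}-{h}. z (n + h) * cnj (z (n + h'))) + z (n+h) * cnj (z (n+h)))"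
        by (intro sum.cong refl) (subst sum.remove, auto)
      finally show ?thesis by (simp only: complex_norm_square)
    qed
    define offd where "offd = (\<lambda>n. (1 / of_nat H)\<^sup>2 * (\<Sum>h<H. \<Sum>h'\<in>{..<H}-{h}. z (n + h)
        * cnj (z (n + h'))))"
    have "has_mean offd ((1 / of_nat H)\<^sup>2 * (\<Sum>h<H. \<Sum>h'\<in>{..<H}-{h}. 0))"
      unfolding offd_def by (intro has_mean_cmult has_mean_sum off) auto
    hence offm: "has_mean offd 0" by simp
    have wle: "(norm (w n))\<^sup>2 \<le> Re (offd n) + 1 / real H" for n
    proof -
      have "complex_of_real ((norm (w n))\<^sup>2) = offd n + complex_of_real ((1 / real H)\<^sup>2
          * (\<Sum>h<H. (norm (z (n+h)))\<^sup>2))"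
        unfolding sq offd_def by (simp add: sum.distrib algebra_simps)
      hence "(norm (w n))\<^sup>2 = Re (offd n) + (1 / real H)\<^sup>2 * (\<Sum>h<H. (norm (z (n+h)))\<^sup>2)"
        by (metis Re_complex_of_real plus_complex.simps(1))
      also have "(\<Sum>h<H. (norm (z (n+h)))\<^sup>2) \<le> (\<Sum>h<H. 1)"
        by (intro sum_mono power_le_one bd) auto
      finally show ?thesis using H0 by (simp add: power2_eq_square field_simps mult_left_mono)
    qed
    obtain N1 where N1: "\<And>N. N \<ge> N1 \<Longrightarrow> norm ((\<Sum>n<N. offd n) / of_nat N) < 1 / real H"
      using LIMSEQ_D[OF offm[unfolded has_mean_def], of "1 / real H"] H0 by auto
    obtain N2 where N2: "\<And>N. N \<ge> N2 \<Longrightarrow> norm ((\<Sum>n<N. w n - z n) / of_nat N) < r / 2"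
      using LIMSEQ_D[OF zw[unfolded has_mean_def], of "r / 2"] r by auto
    have "norm ((\<Sum>n<N. z n) / of_nat N) < r" if N: "N \<ge> max 1 (max N1 N2)" for N
    proof -
      have N0: "real N > 0" using N by simp
      have "(norm ((\<Sum>n<N. w n) / of_nat N))\<^sup>2 \<le> (\<Sum>n<N. (norm (w n))\<^sup>2) / real N"
        by (rule norm_mean_square_le)
      also have "\<dots> \<le> (\<Sum>n<N. Re (offd n) + 1 / real H) / real N"
        by (intro divide_right_mono sum_mono wle) auto
      also have "\<dots> = Re ((\<Sum>n<N. offd n) / of_nat N) + 1 / real H"
        using N0 by (simp add: sum.distrib add_divide_distrib)
      also have "\<dots> \<le> 2 / real H"
        using N1[of N] N complex_Re_le_cmod[of "(\<Sum>n<N. offd n) / of_nat N"] by auto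
      finally have "(norm ((\<Sum>n<N. w n) / of_nat N))\<^sup>2 \<le> (r / 2)\<^sup>2" using Hr by linarith
      hence "norm ((\<Sum>n<N. w n) / of_nat N) \<le> r / 2" using r by (simp add: power2_le_iff_abs_le)
      moreover have "(\<Sum>n<N. z n) / of_nat N = (\<Sum>n<N. w n) / of_nat N - (\<Sum>n<N. w n - z n) / of_nat N"
        by (simp add: sum_subtractf diff_divide_distrib)
      moreover have "norm ((\<Sum>n<N. w n - z n) / of_nat N) < r / 2" using N2 N by simp
      ultimately show ?thesis
        using norm_triangle_ineq4[of "(\<Sum>n<N. w n) / of_nat N" "(\<Sum>n<N. w n - z n) / of_nat N"]
            by simp
    qed
    thus "\<exists>no. \<forall>n\<ge>no. norm ((\<Sum>n<n. z n) / of_nat n - 0) < r"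
      by (intro exI[of _ "max 1 (max N1 N2)"] allI impI) simp
  qed
qed


subsection \<open>Exponential sums over powers\<close>

definition fwd_diff :: "(nat \<Rightarrow> real) \<Rightarrow> nat \<Rightarrow> real" where
  "fwd_diff u n = u (Suc n) - u n"

text \<open>Write \<open>d\<close> for the difference of \<open>u\<close>. For small
  \<open>d n\<close> the increment of \<open>e (u n)\<close> is close to
  \<open>2 * pi * \<i> * d n * e (u n)\<close>, so division by \<open>d n\<close> turns each term
  into a weighted increment. Summation by parts with the monotone weights \<open>1 / d n\<close>
  bounds the sum of these by \<open>2 / d N\<close>, which is \<open>o(N)\<close> because
  \<open>N * d N\<close> is unbounded. The linearisation error is a sum of multiples of
  \<open>d n\<close>, which is \<open>o(N)\<close> because \<open>d n\<close> tends to
  \<open>0\<close>.\<close>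

lemma Fejer_difference:
  assumes pos: "\<And>n. fwd_diff u n > 0"
    and dec: "\<And>n. fwd_diff u (Suc n) \<le> fwd_diff u n"
    and lim: "fwd_diff u \<longlonglongrightarrow> 0"
    and inf: "filterlim (\<lambda>n. real n * fwd_diff u n) at_top sequentially"
  shows "has_mean (\<lambda>n. e (u n)) 0"
proof -
  define d where "d = fwd_diff u"
  define g where "g = (\<lambda>n. 1 / d n)"
  define E where "E = (\<lambda>n. e (u n))"
  note pos = pos[folded d_def] and dec = dec[folded d_def]
  have gpos: "g n > 0" and gmono: "g n \<le> g (Suc n)" for n
    using pos dec by (auto simp: g_def frac_le)
  have parts: "(\<Sum>n<N. (E (Suc n) - E n) * of_real (g n)) = E N * of_real (g N) - E 0 * of_real (g 0)
      - (\<Sum>n<N. E (Suc n) * of_real (g (Suc n) - g n))" for N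
    by (induction N) (simp_all add: algebra_simps)
  \<comment> \<open>The boundary terms have norms \<open>g N\<close> and \<open>g 0\<close>, and the
    monotone weights telescope to \<open>g N - g 0\<close>; the total is
    \<open>2 * g N\<close>.\<close>
  have b1: "norm (\<Sum>n<N. (E (Suc n) - E n) * of_real (g n)) \<le> 2 * g N" for N
  proof -
    have "norm (\<Sum>n<N. E (Suc n) * of_real (g (Suc n) - g n)) \<le> (\<Sum>n<N. g (Suc n) - g n)"
      by (intro sum_norm_le) (use gmono in \<open>simp add: norm_mult E_def del: of_real_diff\<close>)
    also have "\<dots> = g N - g 0" by (rule sum_lessThan_telescope)
    finally have "norm (\<Sum>n<N. E (Suc n) * of_real (g (Suc n) - g n)) \<le> g N - g 0" .
    moreover have "norm (E N * of_real (g N)) = g N" "norm (E 0 * of_real (g 0)) = g 0"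
      using gpos[of N] gpos[of 0] by (auto simp: norm_mult E_def)
    ultimately show ?thesis unfolding parts
      using norm_triangle_ineq4[of "E N * of_real (g N) - E 0 * of_real (g 0)" "\<Sum>n<N. E (Suc n)
          * of_real (g (Suc n) - g n)"]
        norm_triangle_ineq4[of "E N * of_real (g N)" "E 0 * of_real (g 0)"] by linarith
  qed
  \<comment> \<open>The quadratic Taylor error, multiplied by the weight
    \<open>g n = 1 / d n\<close>, leaves one factor \<open>d n\<close>.\<close>
  have b2: "norm ((2 * pi * \<i>) * E n - (E (Suc n) - E n) * of_real (g n)) \<le> (2 * pi)\<^sup>2 * \<bar>d n\<bar>" for
      n
  proof -
    have "E (Suc n) - E n = E n * (cis (2 * pi * d n) - 1)"
      using e_add[of "u n" "d n"] unfolding e_cis[symmetric]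
      by (simp add: E_def d_def fwd_diff_def right_diff_distrib)
    hence "(2 * pi * \<i>) * E n - (E (Suc n) - E n) * of_real (g n)
        = - (E n * of_real (g n) * (cis (2 * pi * d n) - 1 - \<i> * of_real (2 * pi * d n)))"
    proof -
      have "complex_of_real (g n) * of_real (d n) = 1"
        using pos[of n] by (simp add: g_def flip: of_real_mult)
      moreover have "E n * of_real (g n) * (\<i> * of_real (2 * pi * d n)) = (2 * pi * \<i>) * E n
          * (of_real (g n) * of_real (d n))"
        by simp
      ultimately show ?thesis
        unfolding \<open>E (Suc n) - E n = _\<close> by algebra
    qed
    hence "norm ((2 * pi * \<i>) * E n - (E (Suc n) - E n) * of_real (g n))
        = g n * norm (cis (2 * pi * d n) - 1 - \<i> * of_real (2 * pi * d n))"
      using gpos[of n] by (simp add: norm_mult E_def)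
    also have "\<dots> \<le> g n * (2 * pi * d n)\<^sup>2"
      using gpos[of n] by (intro mult_left_mono norm_cis_taylor2) auto
    also have "\<dots> = (2 * pi)\<^sup>2 * \<bar>d n\<bar>"
      using pos[of n] by (simp add: g_def power2_eq_square)
    finally show ?thesis .
  qed
  have bound: "norm ((\<Sum>n<N. (2 * pi * \<i>) * E n) / of_nat N) \<le> 2 * inverse (real N * d N)
      + (2 * pi)\<^sup>2 * ((\<Sum>n<N. \<bar>d n\<bar>) / real N)" for N
  proof -
    have "norm (\<Sum>n<N. (2 * pi * \<i>) * E n) = norm ((\<Sum>n<N. (2 * pi * \<i>) * E n - (E (Suc n) - E n)
        * of_real (g n)) + (\<Sum>n<N. (E (Suc n) - E n) * of_real (g n)))"
      by (simp add: sum_subtractf)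
    also have "\<dots> \<le> (\<Sum>n<N. (2 * pi)\<^sup>2 * \<bar>d n\<bar>) + 2 * g N"
      by (intro norm_triangle_le add_mono sum_norm_le b1 b2)
    finally have "norm (\<Sum>n<N. (2 * pi * \<i>) * E n) / real N \<le> ((\<Sum>n<N. (2 * pi)\<^sup>2 * \<bar>d n\<bar>) + 2 * g N)
        / real N"
      by (intro divide_right_mono) auto
    moreover have "((\<Sum>n<N. (2 * pi)\<^sup>2 * \<bar>d n\<bar>) + 2 * g N) / real N
        = 2 * inverse (real N * d N) + (2 * pi)\<^sup>2 * ((\<Sum>n<N. \<bar>d n\<bar>) / real N)"
      unfolding sum_distrib_left[symmetric] g_def by (simp add: divide_inverse algebra_simps)
    ultimately show ?thesis by (simp only: norm_divide norm_of_nat)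
  qed
  have "(\<lambda>N. 2 * inverse (real N * d N) + (2 * pi)\<^sup>2 * ((\<Sum>n<N. \<bar>d n\<bar>) / real N)) \<longlonglongrightarrow> 2 * 0
      + (2 * pi)\<^sup>2 * 0"
    using inf lim by (intro tendsto_intros cesaro_null tendsto_inverse_0_at_top) (auto simp: d_def)
  hence "has_mean (\<lambda>n. (2 * pi * \<i>) * E n) 0" unfolding has_mean_def
    by (intro Lim_null_comparison[OF always_eventually[OF allI[OF bound]]]) simp
  from has_mean_cmult[OF this, of "1 / (2 * pi * \<i>)"] show ?thesis
    by (simp add: E_def)
qed

lemma fwd_diff_pow_shift: "(fwd_diff ^^ k) (\<lambda>n. u (n + h)) n = (fwd_diff ^^ k) u (n + h)"
  by (induction k arbitrary: n) (simp_all add: fwd_diff_def)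

lemma fwd_diff_pow_diff: "(fwd_diff ^^ k) (\<lambda>n. u n - v n) n = (fwd_diff ^^ k) u n - (fwd_diff ^^ k)
    v n"
  by (induction k arbitrary: n) (simp_all add: fwd_diff_def)

lemma fwd_diff_pow_cmult: "(fwd_diff ^^ k) (\<lambda>n. a * u n) n = a * (fwd_diff ^^ k) u n"
  by (induction k arbitrary: n) (simp_all add: fwd_diff_def algebra_simps)

text \<open>Induction on the order. A van der Corput step replaces \<open>u n\<close> by
  \<open>u (n + h) - u n\<close>, whose difference of order \<open>k + 1\<close> is a sum of
  \<open>h\<close> shifts of the difference of \<open>u\<close> of order \<open>k + 2\<close>. Such
  a sum inherits positivity, monotonicity and both limit conditions, so the order drops by one at
  each step, down to Fejer's theorem.\<close>

lemma van_der_Corput_difference: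
  assumes pos: "\<And>n. n \<ge> n0 \<Longrightarrow> (fwd_diff ^^ Suc k) u n > 0"
    and dec: "\<And>n. n \<ge> n0 \<Longrightarrow> (fwd_diff ^^ Suc k) u (Suc n) \<le> (fwd_diff ^^ Suc k) u n"
    and lim: "(fwd_diff ^^ Suc k) u \<longlonglongrightarrow> 0"
    and inf: "filterlim (\<lambda>n. real n * (fwd_diff ^^ Suc k) u n) at_top sequentially"
  shows "has_mean (\<lambda>n. e (u n)) 0"
  using assms
proof (induction k arbitrary: u)
  case 0
  have fd: "fwd_diff (\<lambda>n. u (n + n0)) = (\<lambda>n. fwd_diff u (n + n0))"
      by (simp add: fwd_diff_def fun_eq_iff)
  have lim: "(\<lambda>n. fwd_diff u (n + n0)) \<longlonglongrightarrow> 0" using 0(3) by (simp add: LIMSEQ_ignore_initial_segment)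
  have "filterlim (\<lambda>n. real (n + n0) * fwd_diff u (n + n0)) at_top sequentially"
    using filterlim_compose[OF 0(4) filterlim_add_const_nat_at_top[of n0]] by simp
  \<comment> \<open>The weight changes from \<open>n + n0\<close> to \<open>n\<close> at the cost of
    \<open>n0\<close> times a null sequence.\<close>
  moreover have "(\<lambda>n. - real n0 * fwd_diff u (n + n0)) \<longlonglongrightarrow> - real n0 * 0"
    by (intro tendsto_intros lim)
  ultimately have "filterlim (\<lambda>n. - real n0 * fwd_diff u (n + n0) + real (n + n0) * fwd_diff u
      (n + n0)) at_top sequentially"
    by (rule filterlim_tendsto_add_at_top[rotated])
  hence "filterlim (\<lambda>n. real n * fwd_diff u (n + n0)) at_top sequentially"
    by (simp add: algebra_simps)
  hence "has_mean (\<lambda>n. e (u (n + n0))) 0"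
    using 0(1,2) lim by (intro Fejer_difference) (simp_all add: fd)
  thus ?case using has_mean_shift_iff[of "\<lambda>n. e (u n)" n0 0] by simp
next
  case (Suc k)
  define D where "D = (fwd_diff ^^ Suc (Suc k)) u"
  note S = Suc.prems[folded D_def]
  show ?case
  proof (rule van_der_Corput)
    fix h :: nat assume h: "h > 0"
    define v where "v = (\<lambda>n. u (n + h) - u n)"
    have v: "(fwd_diff ^^ Suc k) v = (\<lambda>n. \<Sum>j<h. D (n + j))"
    proof
      fix n
      have "(\<Sum>j<h. D (n + j)) = (\<Sum>j<h. (fwd_diff ^^ Suc k) u (n + Suc j) - (fwd_diff ^^ Suc k) u
          (n + j))"
        by (simp add: D_def fwd_diff_def)
      also have "\<dots> = (fwd_diff ^^ Suc k) u (n + h) - (fwd_diff ^^ Suc k) u n"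
        by (subst sum_lessThan_telescope) simp
      also have "\<dots> = (fwd_diff ^^ Suc k) v n"
        unfolding v_def fwd_diff_pow_diff fwd_diff_pow_shift ..
      finally show "(fwd_diff ^^ Suc k) v n = (\<Sum>j<h. D (n + j))" ..
    qed
    have "has_mean (\<lambda>n. e (v n)) 0"
    proof (rule Suc.IH, unfold v)
      show "(\<Sum>j<h. D (n + j)) > 0" if "n \<ge> n0" for n
        using S(1) h that by (intro sum_pos) auto
      show "(\<Sum>j<h. D (Suc n + j)) \<le> (\<Sum>j<h. D (n + j))" if "n \<ge> n0" for n
        using S(2) that by (intro sum_mono) auto
      have "(\<lambda>n. \<Sum>j<h. D (n + j)) \<longlonglongrightarrow> (\<Sum>j<h. 0)"
        using S(3) by (intro tendsto_sum LIMSEQ_ignore_initial_segment)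
      thus "(\<lambda>n. \<Sum>j<h. D (n + j)) \<longlonglongrightarrow> 0" by simp
      show "filterlim (\<lambda>n. real n * (\<Sum>j<h. D (n + j))) at_top sequentially"
      proof (rule filterlim_at_top_mono[OF S(4)])
        show "\<forall>\<^sub>F n in sequentially. real n * D n \<le> real n * (\<Sum>j<h. D (n + j))"
          using eventually_ge_at_top[of n0]
        proof eventually_elim
          case (elim n)
          \<comment> \<open>All summands are positive, so the one with \<open>j = 0\<close> already
            gives the required growth.\<close>
          have "D (n + 0) \<le> (\<Sum>j<h. D (n + j))"
            using h S(1) elim by (intro member_le_sum) (auto intro: less_imp_le)
          thus ?case by (intro mult_left_mono) auto
        qed
      qed
    qed
    thus "has_mean (\<lambda>n. e (u (n + h)) * cnj (e (u n))) 0"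
      by (simp add: v_def e_minus_cnj)
  qed simp
qed

section \<open>Iterated differences of real powers\<close>

lemma filterlim_nat_powr_at_top:
  assumes "p > 0"
  shows "filterlim (\<lambda>n. real n powr p) at_top sequentially"
proof -
  have "(\<lambda>n. real n powr (- p)) \<longlonglongrightarrow> 0"
    using assms by (intro tendsto_neg_powr filterlim_real_sequentially) auto
  moreover have "\<forall>\<^sub>F n in sequentially. real n powr (- p) > 0"
    using eventually_gt_at_top[of 0] by eventually_elim simp
  ultimately have "filterlim (\<lambda>n. inverse (real n powr (- p))) at_top sequentially"
    by (rule filterlim_inverse_at_top)
  thus ?thesis by (simp add: powr_minus)
qed

text \<open>The iterated forward difference taken at real arguments, so that it can be
  differentiated.\<close>

fun powr_diff :: "real \<Rightarrow> nat \<Rightarrow> real \<Rightarrow> real" where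
  "powr_diff c 0 x = x powr c"
| "powr_diff c (Suc k) x = powr_diff c k (x + 1) - powr_diff c k x"

lemma fwd_diff_pow_powr: "(fwd_diff ^^ k) (\<lambda>n. real n powr c) n = powr_diff c k (real n)"
  by (induction k arbitrary: n) (simp_all add: fwd_diff_def add.commute)

lemma DERIV_powr_diff:
  "x > 0 \<Longrightarrow> (powr_diff c k has_real_derivative c * powr_diff (c - 1) k x) (at x)"
proof (induction k arbitrary: x)
  case 0
  have "((\<lambda>x. x powr c) has_real_derivative c * x powr (c - 1)) (at x)"
    using 0 by (rule has_real_derivative_powr)
  thus ?case by (simp add: fun_eq_iff[of "powr_diff c 0", THEN iffD2])
next
  case (Suc k)
  have "((\<lambda>x. powr_diff c k (x + 1)) has_real_derivative c * powr_diff (c - 1) k (x + 1)) (at x)"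
    using Suc.IH[of "x + 1"] Suc.prems DERIV_shift[of "powr_diff c k" _ x 1] by simp
  from DERIV_diff[OF this Suc.IH[OF Suc.prems]] show ?case
    by (simp add: right_diff_distrib[symmetric])
qed

text \<open>Each application of the mean value theorem trades a difference for a derivative. This
  produces the next factor \<open>c - i\<close>, lowers the exponent by one, and moves the
  intermediate point by less than \<open>1\<close>.\<close>

lemma powr_diff_mean_value:
  "x > 0 \<Longrightarrow> \<exists>\<xi>. x \<le> \<xi> \<and> \<xi> \<le> x + real k \<and> powr_diff c k x = (\<Prod>i<k. c - real i) * \<xi> powr (c - real k)"
proof (induction k arbitrary: c x)
  case 0
  thus ?case by (intro exI[of _ x]) simp
next
  case (Suc k)
  have "\<exists>z. x < z \<and> z < x + 1 \<and> powr_diff c k (x + 1) - powr_diff c k x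
      = (x + 1 - x) * (c * powr_diff (c - 1) k z)"
    using Suc.prems by (intro MVT2 DERIV_powr_diff) auto
  then obtain z where z: "x < z" "z < x + 1" "powr_diff c k (x + 1) - powr_diff c k x
      = c * powr_diff (c - 1) k z"
    by auto
  obtain \<xi> where \<xi>: "z \<le> \<xi>" "\<xi> \<le> z + real k" "powr_diff (c - 1) k z = (\<Prod>i<k. c - 1 - real i)
      * \<xi> powr (c - 1 - real k)"
    using Suc.IH[of z "c - 1"] z Suc.prems by auto
  show ?case
    by (rule exI[of _ \<xi>]) (use z \<xi> in \<open>simp add: prod.lessThan_Suc_shift diff_diff_eq del:
        prod.lessThan_Suc\<close>)
qed

text \<open>Differences of order \<lfloor>c\<rfloor> + 1 behave like a constant times
  \<open>n powr s\<close> with \<open>-1 < s < 0\<close>, since \<open>c\<close> is not an integer.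
  They therefore decrease to zero while \<open>n\<close> times them tends to infinity, as the
  difference criterion requires. Negative \<theta> is handled by conjugation.\<close>

lemma has_mean_e_powr:
  assumes c: "c > 0" "c \<notin> \<int>" and \<theta>: "\<theta> \<noteq> 0"
  shows "has_mean (\<lambda>n. e (\<theta> * real n powr c)) 0"
proof -
  have pos: "has_mean (\<lambda>n. e (\<theta> * real n powr c)) 0" if \<theta>: "\<theta> > 0" for \<theta>
  proof -
    define m where "m = nat \<lfloor>c\<rfloor>"
    have "real m = of_int \<lfloor>c\<rfloor>" using c by (simp add: m_def)
    moreover have "of_int \<lfloor>c\<rfloor> \<noteq> c" using c(2) by (metis Ints_of_int)
    ultimately have m: "real m < c" "c < real m + 1" by linarith+
    define F where "F = (\<Prod>i<Suc m. c - real i)"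
    have F: "F > 0" unfolding F_def using m by (intro prod_pos) auto
    define D where "D = (fwd_diff ^^ Suc m) (\<lambda>n. \<theta> * real n powr c)"
    have D: "D n = \<theta> * powr_diff c (Suc m) (real n)" for n
      unfolding D_def fwd_diff_pow_cmult fwd_diff_pow_powr ..
    define s where "s = c - real (Suc m)"
    have s: "s < 0" "s > -1" using m by (auto simp: s_def)
    \<comment> \<open>The start \<open>n \<ge> 1\<close> keeps the mean value theorem on the
      positive half-line.\<close>
    have \<xi>: "\<exists>\<xi>. real n \<le> \<xi> \<and> \<xi> \<le> real n + real (Suc m) \<and> D n = \<theta> * F * \<xi> powr s" if "n \<ge> 1" for n
      using powr_diff_mean_value[of "real n" "Suc m" c] that
          by (auto simp: D F_def s_def simp del: powr_diff.simps prod.lessThan_Suc)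
    have up: "D n \<le> \<theta> * F * real n powr s" and pos: "D n > 0"
      and lo: "\<theta> * F * (real n + real (Suc m)) powr s \<le> D n" if "n \<ge> 1" for n
    proof -
      obtain \<xi> where \<xi>: "real n \<le> \<xi>" "\<xi> \<le> real n + real (Suc m)" "D n = \<theta> * F * \<xi> powr s"
        using \<xi>[OF \<open>n \<ge> 1\<close>] by blast
      show "D n \<le> \<theta> * F * real n powr s" unfolding \<xi>(3)
        using \<xi> that \<theta> F s by (intro mult_left_mono powr_mono2') auto
      show "D n > 0" unfolding \<xi>(3) using \<xi> that \<theta> F by auto
      show "\<theta> * F * (real n + real (Suc m)) powr s \<le> D n" unfolding \<xi>(3)
        using \<xi> that \<theta> F s by (intro mult_left_mono powr_mono2') auto
    qed
    \<comment> \<open>One further difference carries the extra factor \<open>s < 0\<close>, hence is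
      nonpositive.\<close>
    have dec: "D (Suc n) \<le> D n" if "n \<ge> 1" for n
    proof -
      have n: "real n > 0" using that by simp
      have "D (Suc n) - D n = \<theta> * powr_diff c (Suc (Suc m)) (real n)"
        unfolding D by (simp add: algebra_simps)
      moreover obtain \<xi> where \<xi>:
          "powr_diff c (Suc (Suc m)) (real n) = (\<Prod>i<Suc (Suc m). c - real i)
              * \<xi> powr (c - real (Suc (Suc m)))"
        using powr_diff_mean_value[OF n, of "Suc (Suc m)" c] by blast
      moreover have "(\<Prod>i<Suc (Suc m). c - real i) = F * s"
        by (simp add: F_def s_def)
      moreover have "F * s \<le> 0" using F s by (simp add: mult_nonneg_nonpos)
      ultimately have eq: "D (Suc n) - D n = \<theta> * (F * s * \<xi> powr (c - real (Suc (Suc m))))"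
        and "F * s \<le> 0" by (simp_all only:)
      have "D (Suc n) - D n \<le> 0" unfolding eq
        using \<theta> by (intro mult_nonneg_nonpos[OF _ mult_nonpos_nonneg[OF \<open>F * s \<le> 0\<close>]]) auto
      thus ?thesis by simp
    qed
    show ?thesis
    proof (rule van_der_Corput_difference[of 1 m], unfold D_def[symmetric])
      have "(\<lambda>n. \<theta> * F * real n powr s) \<longlonglongrightarrow> \<theta> * F * 0"
        using s by (intro tendsto_intros tendsto_neg_powr filterlim_real_sequentially) auto
      hence "(\<lambda>n. \<theta> * F * real n powr s) \<longlonglongrightarrow> 0" by simp
      moreover have "\<forall>\<^sub>F n in sequentially. norm (D n) \<le> \<theta> * F * real n powr s"
        using eventually_ge_at_top[of 1]
      proof eventually_elim
        case (elim n)
        thus ?case using up[OF elim] pos[OF elim] by simp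
      qed
      ultimately show "D \<longlonglongrightarrow> 0" by (rule Lim_null_comparison[rotated])
      \<comment> \<open>For \<open>n \<ge> 1\<close> one has
        \<open>n + m + 1 \<le> (m + 2) * n\<close>; as \<open>s < 0\<close>, the lower bound for
        \<open>D n\<close> becomes a pure power of \<open>n\<close>.\<close>
      define C where "C = \<theta> * F * (real m + 2) powr s"
      have C: "C > 0" using \<theta> F by (simp add: C_def)
      have "filterlim (\<lambda>n. C * real n powr (1 + s)) at_top sequentially"
        using s C
            by (intro filterlim_tendsto_pos_mult_at_top[OF tendsto_const] filterlim_nat_powr_at_top)
            auto
      thus "filterlim (\<lambda>n. real n * D n) at_top sequentially"
      proof (rule filterlim_at_top_mono)
        show "\<forall>\<^sub>F n in sequentially. C * real n powr (1 + s) \<le> real n * D n"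
          using eventually_ge_at_top[of 1]
        proof eventually_elim
          case (elim n)
          have "real m * 1 \<le> real m * real n" using elim by (intro mult_left_mono) auto
          hence "((real m + 2) * real n) powr s \<le> (real n + real (Suc m)) powr s"
            using s elim by (intro powr_mono2') (auto simp: algebra_simps)
          hence "\<theta> * F * ((real m + 2) * real n) powr s \<le> \<theta> * F * (real n + real (Suc m)) powr s"
            using \<theta> F by (intro mult_left_mono) auto
          also have "\<dots> \<le> D n" by (rule lo[OF elim])
          finally have "real n * (\<theta> * F * ((real m + 2) * real n) powr s) \<le> real n * D n"
            by (intro mult_left_mono) auto
          thus ?case using elim by (simp add: C_def powr_mult powr_add mult_ac)
        qed
      qed
    qed (use pos dec in auto)
  qed
  show ?thesis
  proof (cases "\<theta> > 0")
    case False
    hence "has_mean (\<lambda>n. cnj (e (- \<theta> * real n powr c))) (cnj 0)"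
      using \<theta> by (intro has_mean_cnj pos) auto
    thus ?thesis by (simp add: cnj_e)
  qed (rule pos)
qed

subsection \<open>Trigonometric approximation of the floor phase\<close>

text \<open>The one-sided kernel: its squared modulus is \<open>M\<close> times the Fejer
  kernel.\<close>

definition dirichlet_kernel :: "nat \<Rightarrow> real \<Rightarrow> complex" where
  "dirichlet_kernel M x = (\<Sum>j<M. e (real j * x))"

lemma dirichlet_kernel_square:
  "complex_of_real ((norm (dirichlet_kernel M x))\<^sup>2) = (\<Sum>j<M. \<Sum>k<M. e ((real j - real k) * x))"
  by (simp add: complex_norm_square dirichlet_kernel_def cnj_sum sum_product left_diff_distrib
      e_minus_cnj
      del: of_real_power)

lemma e_add_of_int: "e (x + of_int k) = e x"
  by (simp add: e_add)

lemma dirichlet_kernel_add_of_int: "dirichlet_kernel M (x + of_int k) = dirichlet_kernel M x"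
proof -
  have "e (real j * (x + of_int k)) = e (real j * x)" for j
    using e_add_of_int[of "real j * x" "int j * k"] by (simp add: ring_distribs)
  thus ?thesis by (simp add: dirichlet_kernel_def)
qed

text \<open>Monotonicity on \<open>[0, 1/2]\<close> and the symmetry of the sine about
  \<open>1/2\<close>. The range up to \<open>1 - \<delta>\<close> accommodates differences of two
  points of the unit interval.\<close>

lemma sin_pi_ge:
  assumes "0 < \<delta>" "\<delta> \<le> 1/2" "\<delta> \<le> \<bar>x\<bar>" "\<bar>x\<bar> \<le> 1 - \<delta>"
  shows "sin (\<delta> * pi) \<le> \<bar>sin (x * pi)\<bar>"
proof -
  have main: "sin (\<delta> * pi) \<le> sin (y * pi)" if "\<delta> \<le> y" "y \<le> 1/2" for y
    using that assms by (intro sin_monotone_2pi_le) (auto intro: order_trans[of _ 0])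
  have "sin (\<delta> * pi) \<le> sin (\<bar>x\<bar> * pi)"
  proof (cases "\<bar>x\<bar> \<le> 1/2")
    case False
    hence "sin (\<delta> * pi) \<le> sin ((1 - \<bar>x\<bar>) * pi)" using assms by (intro main) auto
    also have "\<dots> = sin (\<bar>x\<bar> * pi)" by (simp add: left_diff_distrib sin_diff)
    finally show ?thesis .
  qed (use assms main in auto)
  also have "\<dots> \<le> \<bar>sin (x * pi)\<bar>" by (cases "x \<ge> 0") auto
  finally show ?thesis .
qed

text \<open>The geometric sum has a numerator of norm at most \<open>2\<close>, and its denominator
  stays away from zero when \<open>x\<close> stays away from the integers.\<close>

lemma norm_dirichlet_kernel_le:
  assumes "0 < \<delta>" "\<delta> \<le> 1/2" "\<delta> \<le> \<bar>x\<bar>" "\<bar>x\<bar> \<le> 1 - \<delta>"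
  shows "norm (dirichlet_kernel M x) \<le> 1 / sin (\<delta> * pi)"
proof -
  have s: "sin (\<delta> * pi) > 0" using assms by (intro sin_gt_zero) (auto simp: field_simps)
  have "(e x - 1) * dirichlet_kernel M x = e (real M * x) - 1"
  proof (induction M)
    case (Suc M)
    have "(e x - 1) * dirichlet_kernel (Suc M) x = (e x - 1) * dirichlet_kernel M x + (e x - 1)
        * e (real M * x)"
      by (simp add: dirichlet_kernel_def ring_distribs)
    also have "\<dots> = e x * e (real M * x) - 1" unfolding Suc.IH by (simp add: algebra_simps)
    also have "\<dots> = e (real (Suc M) * x) - 1" by (simp add: e_add ring_distribs)
    finally show ?case .
  qed (simp add: dirichlet_kernel_def)
  hence "norm (e x - 1) * norm (dirichlet_kernel M x) = norm (e (real M * x) - 1)"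
    by (metis norm_mult)
  also have "\<dots> \<le> 2" using norm_triangle_ineq4[of "e (real M * x)" 1] by simp
  finally have "\<bar>sin (x * pi)\<bar> * norm (dirichlet_kernel M x) \<le> 1" by (simp add: norm_e_minus_1)
  moreover have "sin (\<delta> * pi) * norm (dirichlet_kernel M x)
      \<le> \<bar>sin (x * pi)\<bar> * norm (dirichlet_kernel M x)"
    by (intro mult_right_mono sin_pi_ge assms) auto
  ultimately show ?thesis using s by (simp add: field_simps)
qed

lemma norm_dirichlet_kernel_ge:
  assumes "\<bar>x\<bar> \<le> 1 / (6 * real R)"
  shows "real R / 2 \<le> norm (dirichlet_kernel R x)"
proof (cases "R = 0")
  case False
  have "1/2 \<le> Re (e (real j * x))" if "j < R" for j
  proof -
    \<comment> \<open>The constant \<open>6\<close> keeps every angle within \<open>pi / 3\<close>,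
      where the cosine is at least \<open>1/2\<close>.\<close>
    have "real j * \<bar>x\<bar> \<le> real R * (1 / (6 * real R))" using that assms by (intro mult_mono) auto
    hence "2 * pi * \<bar>real j * x\<bar> \<le> 2 * pi * (1/6)" using False
        by (intro mult_left_mono) (auto simp: abs_mult)
    hence "cos (pi / 3) \<le> cos \<bar>2 * pi * (real j * x)\<bar>"
      by (intro cos_monotone_0_pi_le) (auto simp: abs_mult)
    thus ?thesis by (simp add: e_cis cos_60)
  qed
  hence "(\<Sum>j<R. 1/2) \<le> (\<Sum>j<R. Re (e (real j * x)))" by (intro sum_mono) auto
  also have "\<dots> = Re (dirichlet_kernel R x)" by (simp add: dirichlet_kernel_def)
  also have "\<dots> \<le> norm (dirichlet_kernel R x)" by (rule complex_Re_le_cmod)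
  finally show ?thesis by simp
qed simp

lemma e_eq_1_iff: "e x = 1 \<longleftrightarrow> x \<in> \<int>"
proof -
  have "e x = 1 \<longleftrightarrow> norm (e x - 1) = 0" by simp
  also have "\<dots> \<longleftrightarrow> sin (x * pi) = 0" unfolding norm_e_minus_1 by simp
  finally show ?thesis by (simp add: sin_times_pi_eq_0)
qed

lemma e_power: "e x ^ k = e (real k * x)"
  by (induction k) (simp_all add: e_add ring_distribs)

lemma sum_roots_of_unity:
  assumes "\<not> int M dvd r"
  shows "(\<Sum>i<M. e (of_int r * (real i / real M))) = 0"
proof -
  define w where "w = e (of_int r / real M)"
  show ?thesis
  proof (cases "M = 0")
    case False
    have "w \<noteq> 1"
    proof
      assume "w = 1"
      then obtain k where "of_int r / real M = of_int k" unfolding w_def e_eq_1_iff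
          by (auto elim: Ints_cases)
      hence "real_of_int r = of_int (int M * k)" using False by (simp add: field_simps)
      hence "r = int M * k" by (simp only: of_int_eq_iff)
      thus False using assms by simp
    qed
    moreover have "w ^ M = 1" using False by (simp add: w_def e_power)
    moreover have "(\<Sum>i<M. e (of_int r * (real i / real M))) = (\<Sum>i<M. w ^ i)"
      by (simp add: w_def e_power mult_ac)
    ultimately show ?thesis by (simp add: geometric_sum)
  qed simp
qed

text \<open>Expanding the square and summing over the sample points first, orthogonality modulo
  \<open>M\<close> leaves only the \<open>M\<close> diagonal pairs, each contributing
  \<open>M\<close>. Divided by \<open>M^2\<close>, the squared kernels thus form an exact partition
  of unity.\<close>

lemma dirichlet_kernel_partition:
  "(\<Sum>i<M. (norm (dirichlet_kernel M (x - real i / real M)))\<^sup>2) = (real M)\<^sup>2"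
proof -
  have "complex_of_real (\<Sum>i<M. (norm (dirichlet_kernel M (x - real i / real M)))\<^sup>2)
      = (\<Sum>i<M. \<Sum>j<M. \<Sum>k<M. e ((real j - real k) * (x - real i / real M)))"
    unfolding of_real_sum dirichlet_kernel_square ..
  also have "\<dots> = (\<Sum>j<M. \<Sum>i<M. \<Sum>k<M. e ((real j - real k) * (x - real i / real M)))"
    by (rule sum.swap)
  also have "\<dots> = (\<Sum>j<M. \<Sum>k<M. \<Sum>i<M. e ((real j - real k) * (x - real i / real M)))"
    by (intro sum.cong refl sum.swap)
  also have "\<dots> = (\<Sum>j<M. \<Sum>k<M. if j = k then of_nat M else 0)"
  proof (intro sum.cong refl)
    fix j k assume jk: "j \<in> {..<M}" "k \<in> {..<M}"
    show "(\<Sum>i<M. e ((real j - real k) * (x - real i / real M))) = (if j = k then of_nat M else 0)"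
    proof (cases "j = k")
      case False
      \<comment> \<open>A nonzero difference of two indices below \<open>M\<close> has modulus less
        than \<open>M\<close>.\<close>
      have "\<not> int M dvd (int k - int j)"
        using jk False dvd_imp_le_int[of "int k - int j" "int M"] by auto
      from sum_roots_of_unity[OF this]
      have "(\<Sum>i<M. e ((real k - real j) * (real i / real M))) = 0" by simp
      moreover have "(real j - real k) * (x - real i / real M) = (real j - real k) * x
          + (real k - real j) * (real i / real M)" for i
        by algebra
      ultimately show ?thesis using False by (simp add: e_add flip: sum_distrib_left)
    qed simp
  qed
  also have "\<dots> = complex_of_real ((real M)\<^sup>2)" by (simp add: power2_eq_square)
  finally show ?thesis by (simp only: of_real_eq_iff)
qed

text \<open>
  A Fejer-type convolution of \<open>e (- \<alpha> * frac x)\<close>, sampled at the points \<open>i / M\<close>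
  and multiplied by \<open>e (\<alpha> * x)\<close>. All its frequencies lie in \<open>\<alpha> + \<int>\<close>,
  so none vanishes when \<open>\<alpha>\<close> is not an integer.
\<close>
definition floor_approx :: "real \<Rightarrow> nat \<Rightarrow> real \<Rightarrow> complex" where
  "floor_approx \<alpha> M x = (\<Sum>i<M. e (\<alpha> * (x - real i / real M))
      * of_real ((norm (dirichlet_kernel M (x - real i / real M)))\<^sup>2 / (real M)\<^sup>2))"

lemma norm_floor_approx_le: "M > 0 \<Longrightarrow> norm (floor_approx \<alpha> M x) \<le> 1"
proof -
  assume M: "M > 0"
  have "norm (floor_approx \<alpha> M x) \<le> (\<Sum>i<M. (norm (dirichlet_kernel M (x - real i / real M)))\<^sup>2
      / (real M)\<^sup>2)"
    unfolding floor_approx_def by (intro sum_norm_le) (simp add: norm_mult norm_divide norm_power)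
  also have "\<dots> = 1" using M by (simp add: dirichlet_kernel_partition flip: sum_divide_distrib)
  finally show ?thesis .
qed

text \<open>The phase at \<lfloor>x\<rfloor> equals the phase at \<open>x - frac x\<close>, and the
  weights concentrate on sample points near \<open>frac x\<close>. Points within \<delta> cost at
  most the Lipschitz bound. Each of the others has weight at most
  \<open>1 / (M * sin (\<delta> * pi))^2\<close> and phase error at most \<open>2\<close>, and there
  are at most \<open>M\<close> of them.\<close>

lemma floor_approx_error_interior:
  assumes \<delta>: "0 < \<delta>" "\<delta> \<le> 1/2" and M: "M > 0" and x: "\<delta> \<le> frac x" "frac x \<le> 1 - \<delta>"
  shows "norm (e (\<alpha> * of_int \<lfloor>x\<rfloor>) - floor_approx \<alpha> M x) \<le> 2 * pi * \<bar>\<alpha>\<bar> * \<delta> + 2 / (real M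
      * (sin (\<delta> * pi))\<^sup>2)"
proof -
  define t where "t = frac x"
  define w where "w = (\<lambda>i. (norm (dirichlet_kernel M (x - real i / real M)))\<^sup>2 / (real M)\<^sup>2)"
  \<comment> \<open>By periodicity the weights depend on the fractional part only.\<close>
  have w_t: "w i = (norm (dirichlet_kernel M (t - real i / real M)))\<^sup>2 / (real M)\<^sup>2" for i
    using dirichlet_kernel_add_of_int[of M "t - real i / real M" "\<lfloor>x\<rfloor>"]
    by (simp add: w_def t_def frac_def)
  have w0: "w i \<ge> 0" for i by (simp add: w_def)
  have w1: "(\<Sum>i<M. w i) = 1"
    using M by (simp add: w_def dirichlet_kernel_partition flip: sum_divide_distrib)
  have "e (\<alpha> * of_int \<lfloor>x\<rfloor>) - floor_approx \<alpha> M x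
      = (\<Sum>i<M. (e (\<alpha> * of_int \<lfloor>x\<rfloor>) - e (\<alpha> * (x - real i / real M))) * of_real (w i))"
  proof -
    have "floor_approx \<alpha> M x = (\<Sum>i<M. e (\<alpha> * (x - real i / real M)) * of_real (w i))"
      by (simp only: floor_approx_def w_def)
    thus ?thesis using w1
        by (simp add: left_diff_distrib sum_subtractf flip: sum_distrib_left of_real_sum)
  qed
  also have "norm \<dots> \<le> (\<Sum>i<M. 2 * pi * \<bar>\<alpha>\<bar> * \<delta> * w i + 2 / ((real M)\<^sup>2 * (sin (\<delta> * pi))\<^sup>2))"
  proof (intro sum_norm_le)
    fix i assume "i \<in> {..<M}"
    hence i: "0 \<le> real i / real M" "real i / real M < 1" by auto
    let ?d = "norm (e (\<alpha> * of_int \<lfloor>x\<rfloor>) - e (\<alpha> * (x - real i / real M)))"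
    have "norm ((e (\<alpha> * of_int \<lfloor>x\<rfloor>) - e (\<alpha> * (x - real i / real M))) * of_real (w i)) = ?d * w i"
      using w0[of i] by (simp add: norm_mult)
    also have "\<dots> \<le> 2 * pi * \<bar>\<alpha>\<bar> * \<delta> * w i + 2 / ((real M)\<^sup>2 * (sin (\<delta> * pi))\<^sup>2)"
    proof (cases "\<bar>t - real i / real M\<bar> \<le> \<delta>")
      case True
      have "?d \<le> 2 * pi * \<bar>\<alpha> * of_int \<lfloor>x\<rfloor> - \<alpha> * (x - real i / real M)\<bar>" by (rule norm_e_diff_le)
      also have "\<alpha> * of_int \<lfloor>x\<rfloor> - \<alpha> * (x - real i / real M) = - (\<alpha> * (t - real i / real M))"
        by (simp add: t_def frac_def algebra_simps)
      also have "2 * pi * \<bar>\<dots>\<bar> = 2 * pi * \<bar>\<alpha>\<bar> * \<bar>t - real i / real M\<bar>"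
        by (simp add: abs_mult)
      also have "\<dots> \<le> 2 * pi * \<bar>\<alpha>\<bar> * \<delta>" using True by (intro mult_left_mono) auto
      finally have "?d * w i \<le> 2 * pi * \<bar>\<alpha>\<bar> * \<delta> * w i" by (intro mult_right_mono w0)
      thus ?thesis by (simp add: add_increasing2)
    next
      case False
      have "norm (dirichlet_kernel M (t - real i / real M)) \<le> 1 / sin (\<delta> * pi)"
      proof (rule norm_dirichlet_kernel_le[OF \<delta>])
        show "\<delta> \<le> \<bar>t - real i / real M\<bar>" using False by simp
        \<comment> \<open>Here the distance of \<open>frac x\<close> from both ends is used: a
          sample point near the opposite end would be close modulo \<open>1\<close> and carry large
          weight.\<close>
        show "\<bar>t - real i / real M\<bar> \<le> 1 - \<delta>" using x i unfolding t_def by linarith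
      qed
      hence "(norm (dirichlet_kernel M (t - real i / real M)))\<^sup>2 \<le> (1 / sin (\<delta> * pi))\<^sup>2"
        by (intro power_mono) auto
      hence "w i \<le> (1 / sin (\<delta> * pi))\<^sup>2 / (real M)\<^sup>2"
        unfolding w_t by (intro divide_right_mono) auto
      hence "w i \<le> 1 / ((real M)\<^sup>2 * (sin (\<delta> * pi))\<^sup>2)"
        by (simp add: power_divide mult.commute)
      moreover have "?d \<le> 2"
          using norm_triangle_ineq4[of "e (\<alpha> * of_int \<lfloor>x\<rfloor>)" "e (\<alpha> * (x - real i / real M))"] by simp
      ultimately have "?d * w i \<le> 2 * (1 / ((real M)\<^sup>2 * (sin (\<delta> * pi))\<^sup>2))"
        using w0 by (intro mult_mono) auto
      hence "?d * w i \<le> 2 / ((real M)\<^sup>2 * (sin (\<delta> * pi))\<^sup>2)" by simp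
      moreover have "0 \<le> 2 * pi * \<bar>\<alpha>\<bar> * \<delta> * w i" using \<delta> w0 by simp
      ultimately show ?thesis by linarith
    qed
    finally show "norm ((e (\<alpha> * of_int \<lfloor>x\<rfloor>) - e (\<alpha> * (x - real i / real M))) * of_real (w i))
      \<le> 2 * pi * \<bar>\<alpha>\<bar> * \<delta> * w i + 2 / ((real M)\<^sup>2 * (sin (\<delta> * pi))\<^sup>2)" .
  qed
  also have "\<dots> = 2 * pi * \<bar>\<alpha>\<bar> * \<delta> + 2 / (real M * (sin (\<delta> * pi))\<^sup>2)"
    using w1 M by (simp add: sum.distrib power2_eq_square[of "real M"] flip: sum_distrib_left)
  finally show ?thesis .
qed

text \<open>
  The last summand absorbs the discontinuity: near integers it is at least \<open>2\<close>, the trivial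
  bound for the error, but its mean along \<open>P * n powr c\<close> is only \<open>8 / R\<close>.
\<close>
lemma floor_approx_error:
  assumes R: "R > 0" and M: "M > 0"
  shows "norm (e (\<alpha> * of_int \<lfloor>x\<rfloor>) - floor_approx \<alpha> M x)
    \<le> 2 * pi * \<bar>\<alpha>\<bar> * (1 / (6 * real R)) + 2 / (real M * (sin (1 / (6 * real R) * pi))\<^sup>2)
      + 8 / (real R)\<^sup>2 * (norm (dirichlet_kernel R x))\<^sup>2"
proof (cases "1 / (6 * real R) \<le> frac x \<and> frac x \<le> 1 - 1 / (6 * real R)")
  case True
  have "norm (e (\<alpha> * of_int \<lfloor>x\<rfloor>) - floor_approx \<alpha> M x)
    \<le> 2 * pi * \<bar>\<alpha>\<bar> * (1 / (6 * real R)) + 2 / (real M * (sin (1 / (6 * real R) * pi))\<^sup>2)"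
    using True R M by (intro floor_approx_error_interior) (auto simp: field_simps)
  thus ?thesis by (simp add: add_increasing2)
next
  case False
  have "\<exists>k. \<bar>x - of_int k\<bar> \<le> 1 / (6 * real R)"
  proof (cases "frac x < 1 / (6 * real R)")
    case True
    thus ?thesis by (intro exI[of _ "\<lfloor>x\<rfloor>"]) (use frac_ge_0[of x] in \<open>simp add: frac_def\<close>)
  next
    case F: False
    hence "frac x > 1 - 1 / (6 * real R)" using False by linarith
    thus ?thesis using frac_lt_1[of x] by (intro exI[of _ "\<lfloor>x\<rfloor> + 1"]) (auto simp: frac_def abs_if)
  qed
  then obtain k where "\<bar>x - of_int k\<bar> \<le> 1 / (6 * real R)" by blast
  hence "real R / 2 \<le> norm (dirichlet_kernel R (x - of_int k))" by (rule norm_dirichlet_kernel_ge)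
  also have "dirichlet_kernel R (x - of_int k) = dirichlet_kernel R x"
    using dirichlet_kernel_add_of_int[of R x "-k"] by simp
  finally have "(real R / 2)\<^sup>2 \<le> (norm (dirichlet_kernel R x))\<^sup>2" by (intro power_mono) auto
  \<comment> \<open>The factor \<open>8 / R^2\<close> is chosen so that a kernel of norm at least
    \<open>R / 2\<close> yields \<open>2\<close>.\<close>
  hence "2 \<le> 8 / (real R)\<^sup>2 * (norm (dirichlet_kernel R x))\<^sup>2" using R by (simp add: field_simps)
  moreover have "norm (e (\<alpha> * of_int \<lfloor>x\<rfloor>) - floor_approx \<alpha> M x) \<le> 2"
    using norm_triangle_ineq4[of "e (\<alpha> * of_int \<lfloor>x\<rfloor>)" "floor_approx \<alpha> M x"]
        norm_floor_approx_le[OF M, of \<alpha> x] by simp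
  moreover have "0 \<le> 2 * pi * \<bar>\<alpha>\<bar> * (1 / (6 * real R))" by simp
  moreover have "0 \<le> 2 / (real M * (sin (1 / (6 * real R) * pi))\<^sup>2)" by simp
  ultimately show ?thesis by linarith
qed

lemma floor_approx_exists:
  assumes "\<epsilon> > 0"
  obtains R M where "R > 0" "M > 0" "8 / real R \<le> \<epsilon>"
    "\<And>x. norm (e (\<alpha> * of_int \<lfloor>x\<rfloor>) - floor_approx \<alpha> M x) \<le> \<epsilon> + 8 / (real R)\<^sup>2
        * (norm (dirichlet_kernel R x))\<^sup>2"
proof -
  \<comment> \<open>\<open>R\<close> controls both the contribution near integers and the phase
    error.\<close>
  obtain R :: nat where R: "real R > max (8 / \<epsilon>) (2 * pi * \<bar>\<alpha>\<bar> / \<epsilon>)" using reals_Archimedean2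
      by blast
  have "real R > 0" using R assms by (smt (verit) divide_pos_pos max_less_iff_conj)
  hence R0: "R > 0" by simp
  have 1: "8 / real R \<le> \<epsilon>" using R assms R0 by (simp add: field_simps)
  have "2 * pi * \<bar>\<alpha>\<bar> / 6 \<le> \<epsilon> * real R / 6" using R assms R0 by (simp add: field_simps)
  hence "2 * pi * \<bar>\<alpha>\<bar> * (1 / (6 * real R)) \<le> \<epsilon> / 6" using R0 by (simp add: field_simps)
  hence 2: "2 * pi * \<bar>\<alpha>\<bar> * (1 / (6 * real R)) \<le> \<epsilon> / 2" using assms by linarith
  define s where "s = sin (1 / (6 * real R) * pi)"
  have s: "s > 0" unfolding s_def using R0 by (intro sin_gt_zero) (auto simp: field_simps)
  \<comment> \<open>Only now, with the width \<open>1 / (6 * R)\<close> fixed, is \<open>M\<close>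
    taken large enough to beat the factor \<open>1 / s^2\<close>.\<close>
  obtain M :: nat where M: "real M > 4 / (\<epsilon> * s\<^sup>2)" using reals_Archimedean2 by blast
  have "real M > 0" using M assms s by (smt (verit) divide_pos_pos mult_pos_pos zero_less_power)
  hence M0: "M > 0" by simp
  have 3: "2 / (real M * s\<^sup>2) \<le> \<epsilon> / 2" using M assms s M0 by (simp add: field_simps)
  show ?thesis
  proof (rule that[OF R0 M0 1])
    fix x
    show "norm (e (\<alpha> * of_int \<lfloor>x\<rfloor>) - floor_approx \<alpha> M x) \<le> \<epsilon> + 8 / (real R)\<^sup>2
        * (norm (dirichlet_kernel R x))\<^sup>2"
      using floor_approx_error[OF R0 M0, of \<alpha> x] 2 3 unfolding s_def[symmetric] by linarith
  qed
qed

text \<open>The form as a trigonometric polynomial: the sample index \<open>i\<close> enters only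
  the coefficient, so the frequencies are \<alpha> shifted by the integers
  \<open>j - k\<close>.\<close>

lemma floor_approx_expand:
  "floor_approx \<alpha> M x = (\<Sum>(i,j,k)\<in>{..<M}\<times>{..<M}\<times>{..<M}.
     (e (- ((\<alpha> + real j - real k) * (real i / real M))) / of_real ((real M)\<^sup>2))
         * e ((\<alpha> + real j - real k) * x))"
proof -
  have "e (\<alpha> * y) * e ((real j - real k) * y) = e ((\<alpha> + real j - real k) * y)" for j k y
    by (simp add: algebra_simps flip: e_add)
  hence "floor_approx \<alpha> M x = (\<Sum>i<M. \<Sum>j<M. \<Sum>k<M. e ((\<alpha> + real j - real k) * (x - real i / real M))
      / of_real ((real M)\<^sup>2))"
    unfolding floor_approx_def of_real_divide dirichlet_kernel_square
    by (simp add: sum_distrib_left sum_divide_distrib)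
  also have "\<dots> = (\<Sum>(i,j,k)\<in>{..<M}\<times>{..<M}\<times>{..<M}. e ((\<alpha> + real j - real k) * (x - real i / real M))
      / of_real ((real M)\<^sup>2))"
    by (simp add: sum.cartesian_product)
  also have "\<dots> = (\<Sum>(i,j,k)\<in>{..<M}\<times>{..<M}\<times>{..<M}.
     (e (- ((\<alpha> + real j - real k) * (real i / real M))) / of_real ((real M)\<^sup>2))
         * e ((\<alpha> + real j - real k) * x))"
    by (intro sum.cong refl) (auto simp: right_diff_distrib e_minus_cnj cnj_e)
  finally show ?thesis .
qed

section \<open>Correlations of floor phases along dilated powers\<close>

context
  fixes c :: real
  assumes c: "c > 0" "c \<notin> \<int>"
begin

text \<open>Off-diagonal frequencies have mean zero, and the \<open>R\<close> diagonal terms are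
  constantly \<open>1\<close>.\<close>

lemma has_mean_dirichlet_kernel_square:
  assumes P: "P > 0"
  shows "has_mean (\<lambda>n. of_real ((norm (dirichlet_kernel R (P * real n powr c)))\<^sup>2)) (of_nat R)"
proof -
  have "has_mean (\<lambda>n. \<Sum>j<R. \<Sum>k<R. e ((real j - real k) * (P * real n powr c))) (\<Sum>j<R. \<Sum>k<R. if j
      = k then 1 else 0)"
  proof (intro has_mean_sum)
    fix j k
    show "has_mean (\<lambda>n. e ((real j - real k) * (P * real n powr c))) (if j = k then 1 else 0)"
      using has_mean_e_powr[OF c, of "(real j - real k) * P"] P has_mean_const[of 1]
          by (auto simp: mult.assoc)
  qed
  thus ?thesis unfolding dirichlet_kernel_square by simp
qed

text \<open>The kernel term has mean \<open>8 / R\<close>, which is at most \<epsilon>. Allowing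
  twice the limiting value for all large \<open>N\<close> gives \<open>2 * \<epsilon>\<close>, to
  which the uniform error adds one more \<epsilon>.\<close>

lemma floor_approx_mean_error:
  assumes P: "P > 0" and \<epsilon>: "\<epsilon> > 0" and R: "R > 0" "8 / real R \<le> \<epsilon>"
    and approx: "\<And>x. norm (e (\<alpha> * of_int \<lfloor>x\<rfloor>) - floor_approx \<alpha> M x) \<le> \<epsilon> + 8 / (real R)\<^sup>2
        * (norm (dirichlet_kernel R x))\<^sup>2"
  shows "\<forall>\<^sub>F N in sequentially. (\<Sum>n<N. norm (e (\<alpha> * of_int \<lfloor>P * real n powr c\<rfloor>) - floor_approx \<alpha> M
      (P * real n powr c))) \<le> 3 * \<epsilon> * real N"
proof -
  let ?D = "\<lambda>n. (norm (dirichlet_kernel R (P * real n powr c)))\<^sup>2"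
  have "(\<lambda>N. Re ((\<Sum>n<N. of_real (?D n)) / of_nat N)) \<longlonglongrightarrow> Re (of_nat R)"
    using has_mean_dirichlet_kernel_square[OF P, of R] unfolding has_mean_def by (rule tendsto_Re)
  hence "(\<lambda>N. (\<Sum>n<N. ?D n) / real N) \<longlonglongrightarrow> real R" by simp
  hence "\<forall>\<^sub>F N in sequentially. (\<Sum>n<N. ?D n) / real N < 2 * real R"
    by (rule order_tendstoD) (use R in auto)
  thus ?thesis using eventually_gt_at_top[of 0]
  proof eventually_elim
    case (elim N)
    have "(\<Sum>n<N. norm (e (\<alpha> * of_int \<lfloor>P * real n powr c\<rfloor>) - floor_approx \<alpha> M (P * real n powr c)))
        \<le> (\<Sum>n<N. \<epsilon> + 8 / (real R)\<^sup>2 * ?D n)"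
      by (intro sum_mono approx)
    also have "\<dots> = real N * \<epsilon> + 8 / (real R)\<^sup>2 * (\<Sum>n<N. ?D n)"
      by (simp add: sum.distrib sum_distrib_left)
    also have "\<dots> \<le> real N * \<epsilon> + 8 / (real R)\<^sup>2 * (2 * real R * real N)"
      using elim by (intro add_left_mono mult_left_mono) (auto simp: field_simps)
    also have "\<dots> = real N * \<epsilon> + 2 * (8 / real R) * real N" using R by (simp add: power2_eq_square)
    also have "\<dots> \<le> real N * \<epsilon> + 2 * \<epsilon> * real N" using R
        by (intro add_left_mono mult_right_mono) auto
    finally show ?case by simp
  qed
qed

text \<open>
  The exceptional set \<open>B\<close> depends on \<open>\<epsilon>\<close> only: it consists of the ratios of the finitely
  many frequencies of the approximating trigonometric polynomial.
\<close>
lemma floor_correlation_small: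
  assumes \<alpha>: "\<alpha> \<notin> \<int>" and \<epsilon>: "\<epsilon> > 0"
  shows "\<exists>B. finite B \<and> (\<forall>P Q. P > 0 \<longrightarrow> Q > 0 \<longrightarrow> Q / P \<notin> B \<longrightarrow>
    (\<forall>\<^sub>F N in sequentially. norm (\<Sum>n<N. e (\<alpha> * of_int \<lfloor>P * real n powr c\<rfloor>)
        * cnj (e (\<alpha> * of_int \<lfloor>Q * real n powr c\<rfloor>))) \<le> \<epsilon> * real N))"
proof -
  \<comment> \<open>The budget in eighths of \<epsilon>: three for each of the two approximations
    and one for the polynomial correlation.\<close>
  have \<epsilon>': "\<epsilon> / 8 > 0" using \<epsilon> by simp
  from floor_approx_exists[OF \<epsilon>', of \<alpha>] obtain R M where RM: "R > 0" "M > 0" "8 / real R \<le> \<epsilon> / 8"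
    and approx: "\<And>x. norm (e (\<alpha> * of_int \<lfloor>x\<rfloor>) - floor_approx \<alpha> M x) \<le> \<epsilon> / 8 + 8 / (real R)\<^sup>2
        * (norm (dirichlet_kernel R x))\<^sup>2"
    by metis
  define S where "S = {..<M}\<times>{..<M}\<times>{..<M}"
  define \<mu> where "\<mu> = (\<lambda>(i::nat,j,k). \<alpha> + real j - real k)"
  define w where "w = (\<lambda>(i,j,k). e (- ((\<alpha> + real j - real k) * (real i / real M)))
      / complex_of_real ((real M)\<^sup>2))"
  define G where "G = (\<lambda>x::real. e (\<alpha> * of_int \<lfloor>x\<rfloor>))"
  define T where "T = floor_approx \<alpha> M"
  have T: "T x = (\<Sum>s\<in>S. w s * e (\<mu> s * x))" for x
    unfolding T_def floor_approx_expand S_def by (intro sum.cong) (auto simp: w_def \<mu>_def)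
  have \<mu>0: "\<mu> s \<noteq> 0" for s
  proof
    assume "\<mu> s = 0"
    then obtain j k :: nat where "\<alpha> = real k - real j" by (cases s) (auto simp: \<mu>_def algebra_simps)
    thus False using \<alpha> by auto
  qed
  define B where "B = (\<lambda>(s,s'). \<mu> s / \<mu> s') ` (S \<times> S)"
  have "finite B" unfolding B_def S_def by auto
  moreover have "\<forall>\<^sub>F N in sequentially. norm (\<Sum>n<N. G (P * real n powr c)
      * cnj (G (Q * real n powr c))) \<le> \<epsilon> * real N"
    if P: "P > 0" and Q: "Q > 0" and PQ: "Q / P \<notin> B" for P Q
  proof -
    let ?p = "\<lambda>n. P * real n powr c" and ?q = "\<lambda>n. Q * real n powr c"
    have "has_mean (\<lambda>n. \<Sum>s\<in>S. \<Sum>s'\<in>S. (w s * cnj (w s')) * e ((\<mu> s * P - \<mu> s' * Q) * real n powr c))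
        (\<Sum>s\<in>S. \<Sum>s'\<in>S. (w s * cnj (w s')) * 0)"
    proof (intro has_mean_sum has_mean_cmult has_mean_e_powr c)
      fix s s' assume s: "s \<in> S" "s' \<in> S"
      \<comment> \<open>A vanishing combined frequency would make \<open>Q / P\<close> a ratio of
        two frequencies, hence a member of \<open>B\<close>.\<close>
      show "\<mu> s * P - \<mu> s' * Q \<noteq> 0"
      proof
        assume "\<mu> s * P - \<mu> s' * Q = 0"
        hence "Q / P = \<mu> s / \<mu> s'" using P \<mu>0[of s'] by (simp add: field_simps)
        thus False using PQ s unfolding B_def by force
      qed
    qed
    moreover have "(\<Sum>s\<in>S. \<Sum>s'\<in>S. (w s * cnj (w s')) * e ((\<mu> s * P - \<mu> s' * Q) * real n powr c))
        = T (?p n) * cnj (T (?q n))" for n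
    proof -
      have "e ((\<mu> s * P - \<mu> s' * Q) * y) = e (\<mu> s * (P * y)) * cnj (e (\<mu> s' * (Q * y)))" for s s' y
        by (simp add: left_diff_distrib mult.assoc flip: e_minus_cnj)
      thus ?thesis unfolding T cnj_sum sum_product by (intro sum.cong refl) simp
    qed
    ultimately have "has_mean (\<lambda>n. T (?p n) * cnj (T (?q n))) 0" by simp
    hence "\<forall>\<^sub>F N in sequentially. dist ((\<Sum>n<N. T (?p n) * cnj (T (?q n))) / of_nat N) 0 < \<epsilon> / 8"
      unfolding has_mean_def using \<epsilon>' by (rule tendstoD)
    moreover have "\<forall>\<^sub>F N in sequentially. (\<Sum>n<N. norm (G (?p n) - T (?p n))) \<le> 3 * (\<epsilon> / 8) * real N"
      unfolding G_def T_def using floor_approx_mean_error[OF P \<epsilon>' RM(1,3) approx] .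
    moreover have "\<forall>\<^sub>F N in sequentially. (\<Sum>n<N. norm (G (?q n) - T (?q n))) \<le> 3 * (\<epsilon> / 8) * real N"
      unfolding G_def T_def using floor_approx_mean_error[OF Q \<epsilon>' RM(1,3) approx] .
    ultimately show ?thesis using eventually_gt_at_top[of 0]
    proof eventually_elim
      case (elim N)
      \<comment> \<open>One factor is replaced at a time; the remaining factor is bounded by
        \<open>1\<close> in both cases.\<close>
      have pt: "norm (G (?p n) * cnj (G (?q n)) - T (?p n) * cnj (T (?q n)))
          \<le> norm (G (?p n) - T (?p n)) + norm (G (?q n) - T (?q n))" for n
      proof -
        have "G (?p n) * cnj (G (?q n)) - T (?p n) * cnj (T (?q n)) = (G (?p n) - T (?p n))
            * cnj (G (?q n)) + T (?p n) * cnj (G (?q n) - T (?q n))"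
          by (simp add: algebra_simps)
        also have "norm \<dots> \<le> norm (G (?p n) - T (?p n)) * norm (cnj (G (?q n))) + norm (T (?p n))
            * norm (cnj (G (?q n) - T (?q n)))"
          unfolding norm_mult[symmetric] by (rule norm_triangle_ineq)
        also have "\<dots> = norm (G (?p n) - T (?p n)) + norm (T (?p n)) * norm (G (?q n) - T (?q n))"
          unfolding complex_mod_cnj by (simp add: G_def)
        also have "\<dots> \<le> norm (G (?p n) - T (?p n)) + 1 * norm (G (?q n) - T (?q n))"
          unfolding T_def using norm_floor_approx_le[OF RM(2)]
              by (intro add_left_mono mult_right_mono) auto
        finally show ?thesis by simp
      qed
      have "norm (\<Sum>n<N. T (?p n) * cnj (T (?q n))) \<le> \<epsilon> / 8 * real N"
        using elim by (simp add: norm_divide field_simps)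
      moreover have "norm (\<Sum>n<N. G (?p n) * cnj (G (?q n)) - T (?p n) * cnj (T (?q n)))
          \<le> (\<Sum>n<N. norm (G (?p n) - T (?p n)) + norm (G (?q n) - T (?q n)))"
        by (intro sum_norm_le pt)
      moreover have "\<dots> \<le> 6 * (\<epsilon> / 8) * real N" using elim by (simp add: sum.distrib)
      ultimately have "norm ((\<Sum>n<N. G (?p n) * cnj (G (?q n)) - T (?p n) * cnj (T (?q n)))
          + (\<Sum>n<N. T (?p n) * cnj (T (?q n)))) \<le> 7 * (\<epsilon> / 8) * real N"
        by (intro norm_triangle_le) (simp add: algebra_simps)
      moreover have "7 * (\<epsilon> / 8) * real N \<le> \<epsilon> * real N" using \<epsilon> by simp
      ultimately show ?case by (simp add: sum_subtractf)
    qed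
  qed
  ultimately show ?thesis unfolding G_def by blast
qed

end

subsection \<open>Prime divisors\<close>

lemma squarefree_eq_prod_prime_factors:
  fixes n :: nat
  assumes "squarefree n"
  shows "n = \<Prod>(prime_factors n)"
proof -
  have n: "n \<noteq> 0" using assms by (cases "n = 0") auto
  have "n = (\<Prod>p\<in>prime_factors n. p ^ multiplicity p n)"
    using prod_prime_factors[OF n] by simp
  also have "\<dots> = \<Prod>(prime_factors n)"
    using assms n by (intro prod.cong) (auto simp: squarefree_factorial_semiring'[OF n])
  finally show ?thesis .
qed

text \<open>Such an \<open>n\<close> is a squarefree number times a square. The squarefree part is
  determined by a set of primes below \<open>k\<close>, and the root of the square part is at most
  \<open>W\<close>.\<close>

lemma card_smooth_le:
  "card {n \<in> {1..W\<^sup>2}. \<forall>p. prime p \<longrightarrow> p dvd n \<longrightarrow> p < k} \<le> 2 ^ k * (W :: nat)"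
proof -
  let ?A = "{n \<in> {1..W\<^sup>2}. \<forall>p. prime p \<longrightarrow> p dvd n \<longrightarrow> p < k}"
  let ?h = "\<lambda>n::nat. (prime_factors (squarefree_part n), square_part n)"
  have "inj_on ?h ?A"
  proof (rule inj_onI)
    fix m n assume "?h m = ?h n"
    hence "squarefree_part m = squarefree_part n" "square_part m = square_part n"
      using squarefree_eq_prod_prime_factors[of "squarefree_part m"]
        squarefree_eq_prod_prime_factors[of "squarefree_part n"] by auto
    thus "m = n" using squarefree_decompose[of m] squarefree_decompose[of n] by simp
  qed
  moreover have "?h ` ?A \<subseteq> Pow {..<k} \<times> {1..W}"
  proof (intro image_subsetI)
    fix n assume n: "n \<in> ?A"
    have "p < k" if "p \<in> prime_factors (squarefree_part n)" for p
    proof -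
      have "squarefree_part n dvd n" by (metis squarefree_decompose dvd_triv_left)
      thus ?thesis using that n by (auto simp: in_prime_factors_iff intro: dvd_trans)
    qed
    moreover have "square_part n \<le> W"
    proof -
      have "(square_part n)\<^sup>2 \<le> n" using n by (intro dvd_imp_le) auto
      also have "\<dots> \<le> W\<^sup>2" using n by simp
      finally show ?thesis by (simp add: power2_nat_le_eq_le)
    qed
    moreover have "square_part n \<noteq> 0" using n by simp
    hence "1 \<le> square_part n" by (simp only: One_nat_def Suc_le_eq neq0_conv)
    ultimately show "?h n \<in> Pow {..<k} \<times> {1..W}" by auto
  qed
  ultimately have "card ?A \<le> card (Pow {..<k} \<times> {1..W})"
    by (intro card_inj_on_le) auto
  thus ?thesis by (simp add: card_cartesian_product card_Pow)
qed

lemma card_multiples: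
  assumes "d > 0"
  shows "card {n \<in> {1..<N}. d dvd n} = (N - 1) div d"
proof -
  have "{n \<in> {1..<N}. d dvd n} = (\<lambda>m. d * m) ` {1..(N - 1) div d}"
  proof (intro set_eqI iffI)
    fix n assume "n \<in> {n \<in> {1..<N}. d dvd n}"
    then obtain m where "n = d * m" "1 \<le> n" "n < N" by auto
    thus "n \<in> (\<lambda>m. d * m) ` {1..(N - 1) div d}"
      using assms by (auto simp: less_eq_div_iff_mult_less_eq mult.commute Suc_le_eq)
  next
    fix n assume "n \<in> (\<lambda>m. d * m) ` {1..(N - 1) div d}"
    then obtain m where "n = d * m" "m \<in> {1..(N - 1) div d}" by (rule imageE)
    hence m: "n = d * m" "1 \<le> m" "m \<le> (N - 1) div d" by simp_all
    hence "d * m \<le> N - 1" using assms by (simp add: less_eq_div_iff_mult_less_eq mult.commute)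
    thus "n \<in> {n \<in> {1..<N}. d dvd n}" using m assms by (cases N) (auto simp: Suc_le_eq)
  qed
  moreover have "inj_on (\<lambda>m. d * m) {1..(N - 1) div d}" using assms by (auto simp: inj_on_def)
  ultimately show ?thesis by (simp add: card_image)
qed

lemma card_multiples_le: "d > 0 \<Longrightarrow> real (card {n \<in> {1..<N}. d dvd n}) \<le> real N / real d"
proof -
  assume "d > 0"
  have "real ((N - 1) div d) \<le> real (N - 1) / real d" by (rule of_nat_div_le_of_nat)
  also have "\<dots> \<le> real N / real d" by (intro divide_right_mono) auto
  finally show ?thesis using card_multiples[OF \<open>d > 0\<close>] by simp
qed

lemma card_multiples_ge: "d > 0 \<Longrightarrow> real N / real d - 1 \<le> real (card {n \<in> {1..<N}. d dvd n})"
proof -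
  assume d: "d > 0"
  have "N - 1 < d * ((N - 1) div d) + d"
    using mult_div_mod_eq[of d "N - 1"] mod_less_divisor[OF d, of "N - 1"] by linarith
  hence "N \<le> d * ((N - 1) div d) + d" by linarith
  hence "real N \<le> real d * real ((N - 1) div d) + real d"
    by (metis of_nat_add of_nat_le_iff of_nat_mult)
  thus ?thesis using d card_multiples[OF d, of N] by (simp add: field_simps)
qed

text \<open>
  Erdos' argument: if the tail beyond \<open>k\<close> were below \<open>1/2\<close>, then more than half of the
  integers up to \<open>W\<^sup>2\<close> would have only prime factors below \<open>k\<close>, but there are at most
  \<open>2 ^ k * W\<close> such integers.
\<close>
lemma prime_reciprocals_unbounded:
  "\<exists>n. C < (\<Sum>p | prime p \<and> p < n. 1 / real p)"
proof (rule ccontr)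
  assume *: "\<not> (\<exists>n. C < (\<Sum>p | prime p \<and> p < n. 1 / real p))"
  define S where "S = (\<lambda>n::nat. \<Sum>p | prime p \<and> p < n. 1 / real p)"
  have bd: "S n \<le> C" for n using * by (auto simp: S_def not_less)
  hence bdd: "bdd_above (range S)" by (intro bdd_aboveI[of _ C]) auto
  \<comment> \<open>The partial sums are bounded, so one of them comes within \<open>1/2\<close> of
    the supremum.\<close>
  have "\<exists>k. S k > Sup (range S) - 1/2"
    using less_cSupD[of "range S" "Sup (range S) - 1/2"] by auto
  then obtain k where k: "S k > Sup (range S) - 1/2" by blast
  have tail: "(\<Sum>p | prime p \<and> k \<le> p \<and> p < n. 1 / real p) < 1/2" for n
  proof (cases "k \<le> n")
    case True
    have "{p. prime p \<and> p < n} = {p. prime p \<and> p < k} \<union> {p. prime p \<and> k \<le> p \<and> p < n}" using True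
        by auto
    hence "S n = S k + (\<Sum>p | prime p \<and> k \<le> p \<and> p < n. 1 / real p)"
      unfolding S_def by (simp add: sum.union_disjoint disjoint_iff)
    moreover have "S n \<le> Sup (range S)" by (intro cSup_upper bdd) auto
    ultimately show ?thesis using k by simp
  next
    case False
    hence eq: "{p. prime p \<and> k \<le> p \<and> p < n} = {}" by auto
    show ?thesis unfolding eq by simp
  qed
  \<comment> \<open>With this choice \<open>2 * (2 ^ k * W) = W^2 = N\<close>, so the final strict
    inequality contradicts itself.\<close>
  define W :: nat where "W = 2 ^ Suc k"
  define N where "N = W\<^sup>2"
  let ?A = "{n \<in> {1..N}. \<forall>p. prime p \<longrightarrow> p dvd n \<longrightarrow> p < k}"
  let ?P = "{p. prime p \<and> k \<le> p \<and> p < Suc N}"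
  have fin: "finite ?P" by auto
  have "{1..N} \<subseteq> ?A \<union> (\<Union>p\<in>?P. {n \<in> {1..<Suc N}. p dvd n})"
  proof
    fix n assume n: "n \<in> {1..N}"
    show "n \<in> ?A \<union> (\<Union>p\<in>?P. {n \<in> {1..<Suc N}. p dvd n})"
    proof (cases "n \<in> ?A")
      case False
      then obtain p where p: "prime p" "p dvd n" "k \<le> p" using n by (auto simp: not_less)
      moreover have "p \<le> n" using p n by (intro dvd_imp_le) auto
      ultimately have "p \<in> ?P" "n \<in> {n \<in> {1..<Suc N}. p dvd n}" using n by auto
      thus ?thesis by blast
    qed simp
  qed
  hence "card {1..N} \<le> card (?A \<union> (\<Union>p\<in>?P. {n \<in> {1..<Suc N}. p dvd n}))"
    using fin by (intro card_mono) auto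
  also have "\<dots> \<le> card ?A + card (\<Union>p\<in>?P. {n \<in> {1..<Suc N}. p dvd n})" by (rule card_Un_le)
  also have "\<dots> \<le> 2 ^ k * W + (\<Sum>p\<in>?P. card {n \<in> {1..<Suc N}. p dvd n})"
    unfolding N_def by (intro add_mono card_smooth_le card_UN_le) auto
  finally have "N \<le> 2 ^ k * W + (\<Sum>p\<in>?P. card {n \<in> {1..<Suc N}. p dvd n})" by simp
  hence "real N \<le> real (2 ^ k * W + (\<Sum>p\<in>?P. card {n \<in> {1..<Suc N}. p dvd n}))"
    by (simp only: of_nat_le_iff)
  also have "\<dots> = real (2 ^ k * W) + (\<Sum>p\<in>?P. real (card {n \<in> {1..<Suc N}. p dvd n}))" by simp
  also have "(\<Sum>p\<in>?P. real (card {n \<in> {1..<Suc N}. p dvd n})) \<le> (\<Sum>p\<in>?P. real N * (1 / real p))"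
  proof (intro sum_mono)
    fix p assume "p \<in> ?P"
    hence "p > 0" by (auto simp: prime_gt_0_nat)
    thus "real (card {n \<in> {1..<Suc N}. p dvd n}) \<le> real N * (1 / real p)"
      using card_multiples[of p "Suc N"] of_nat_div_le_of_nat[of N p] by simp
  qed
  also have "\<dots> = real N * (\<Sum>p\<in>?P. 1 / real p)" by (simp add: sum_distrib_left)
  also have "\<dots> < real N * (1/2)"
    by (intro mult_strict_left_mono tail) (simp add: N_def W_def)
  finally have "real N < 2 * real (2 ^ k * W)" by simp
  thus False by (simp add: N_def W_def power2_eq_square)
qed

text \<open>Expanding the square, the terms of size \<open>A^2 * N\<close> cancel between the second
  moment, the linear term and the constant. What is left is the diagonal contribution
  \<open>A * N\<close> and the rounding errors of the first moment.\<close>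

lemma Turan_Kubilius:
  assumes fin: "finite P" and prime: "\<And>p. p \<in> P \<Longrightarrow> prime p"
  defines "A \<equiv> (\<Sum>p\<in>P. 1 / real p)"
  shows "(\<Sum>n\<in>{1..<N}. ((\<Sum>p\<in>P. of_bool (p dvd n)) - A)\<^sup>2) \<le> A * real N + 2 * A * real (card P)"
proof -
  define \<omega> where "\<omega> = (\<lambda>n::nat. \<Sum>p\<in>P. of_bool (p dvd n) :: real)"
  define X where "X = {1..<N}"
  have pos: "p > 0" if "p \<in> P" for p using prime[OF that] by (rule prime_gt_0_nat)
  have cnt: "(\<Sum>n\<in>X. of_bool (d dvd n)) = real (card {n \<in> {1..<N}. d dvd n})" for d
    by (simp add: X_def of_bool_def sum.If_cases Int_def)
  have A0: "A \<ge> 0" unfolding A_def by (simp add: sum_nonneg)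
  \<comment> \<open>The first moment enters with the negative factor \<open>- 2 * A\<close>, so a
    lower bound is what the expansion calls for.\<close>
  have "(\<Sum>n\<in>X. \<omega> n) = (\<Sum>p\<in>P. \<Sum>n\<in>X. of_bool (p dvd n))"
    unfolding \<omega>_def by (rule sum.swap)
  also have "\<dots> \<ge> (\<Sum>p\<in>P. real N / real p - 1)"
    unfolding cnt by (intro sum_mono card_multiples_ge pos)
  also have "(\<Sum>p\<in>P. real N / real p - 1) = A * real N - real (card P)"
    by (simp add: A_def sum_subtractf sum_distrib_right)
  finally have first: "A * real N - real (card P) \<le> (\<Sum>n\<in>X. \<omega> n)" .
  have "(\<Sum>n\<in>X. (\<omega> n)\<^sup>2) = (\<Sum>n\<in>X. \<Sum>p\<in>P. \<Sum>q\<in>P. of_bool (p dvd n \<and> q dvd n))"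
    unfolding \<omega>_def power2_eq_square sum_product by (simp add: of_bool_conj)
  also have "\<dots> = (\<Sum>p\<in>P. \<Sum>n\<in>X. \<Sum>q\<in>P. of_bool (p dvd n \<and> q dvd n))" by (rule sum.swap)
  also have "\<dots> = (\<Sum>p\<in>P. \<Sum>q\<in>P. \<Sum>n\<in>X. of_bool (p dvd n \<and> q dvd n))"
    by (intro sum.cong refl sum.swap)
  \<comment> \<open>The product term is kept on the diagonal as well, so that the double sum factors
    as \<open>A * A\<close>.\<close>
  also have "\<dots> \<le> (\<Sum>p\<in>P. \<Sum>q\<in>P. real N * ((1 / real p) * (1 / real q)) + (if p
      = q then real N * (1 / real p) else 0))"
  proof (intro sum_mono)
    fix p q assume pq: "p \<in> P" "q \<in> P"
    show "(\<Sum>n\<in>X. of_bool (p dvd n \<and> q dvd n)) \<le> real N * ((1 / real p) * (1 / real q)) + (if p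
        = q then real N * (1 / real p) else 0)"
    proof (cases "p = q")
      case True
      have "(\<Sum>n\<in>X. of_bool (p dvd n \<and> q dvd n)) \<le> real N / real p"
        using True cnt[of p] card_multiples_le[OF pos[OF pq(1)], of N] by simp
      thus ?thesis using True by (simp add: add_increasing)
    next
      case False
      hence "coprime p q" using prime pq by (intro primes_coprime) auto
      hence "(p dvd n \<and> q dvd n) \<longleftrightarrow> p * q dvd n" for n
        by (auto intro: divides_mult dvd_mult_left dvd_mult_right)
      hence "(\<Sum>n\<in>X. of_bool (p dvd n \<and> q dvd n)) = (\<Sum>n\<in>X. of_bool (p * q dvd n) :: real)" by simp
      also have "\<dots> \<le> real N / real (p * q)"
        unfolding cnt using pos pq by (intro card_multiples_le) auto
      finally show ?thesis using False by simp
    qed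
  qed
  also have "\<dots> = A * A * real N + A * real N"
    using fin by (simp add: A_def sum.distrib sum_product sum_distrib_left sum_distrib_right
        mult_ac)
  finally have second: "(\<Sum>n\<in>X. (\<omega> n)\<^sup>2) \<le> A * A * real N + A * real N" .
  have "(\<Sum>n\<in>X. (\<omega> n - A)\<^sup>2) = (\<Sum>n\<in>X. (\<omega> n)\<^sup>2) - 2 * A * (\<Sum>n\<in>X. \<omega> n) + real (card X) * A\<^sup>2"
  proof -
    have "(\<omega> n - A)\<^sup>2 = (\<omega> n)\<^sup>2 - 2 * A * \<omega> n + A\<^sup>2" for n by (simp add: power2_diff)
    thus ?thesis by (simp add: sum.distrib sum_subtractf flip: sum_distrib_left)
  qed
  also have "\<dots> \<le> (A * A * real N + A * real N) - 2 * A * (A * real N - real (card P)) + real N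
      * A\<^sup>2"
    using A0 by (intro add_mono diff_mono second mult_left_mono first mult_right_mono)
        (auto simp: X_def)
  also have "\<dots> = A * real N + 2 * A * real (card P)" by (simp add: algebra_simps power2_eq_square)
  finally show ?thesis unfolding X_def \<omega>_def .
qed

lemma sum_multiples:
  fixes F :: "nat \<Rightarrow> 'a :: semiring_1"
  assumes "p > 0"
  shows "(\<Sum>n\<in>{1..<N}. F n * of_bool (p dvd n)) = (\<Sum>m\<in>{1..(N - 1) div p}. F (p * m))"
proof -
  have "(\<Sum>n\<in>{1..<N}. F n * of_bool (p dvd n)) = (\<Sum>n\<in>{n \<in> {1..<N}. p dvd n}. F n)"
    by (intro sum.mono_neutral_cong_right) auto
  also have "\<dots> = (\<Sum>m\<in>{1..(N - 1) div p}. F (p * m))"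
  proof (rule sum.reindex_bij_witness[of _ "\<lambda>m. p * m" "\<lambda>n. n div p"])
    fix n assume "n \<in> {n \<in> {1..<N}. p dvd n}"
    thus "p * (n div p) = n" "n div p \<in> {1..(N - 1) div p}" "F (p * (n div p)) = F n"
      using assms by (auto simp: div_le_mono dvd_div_eq_0_iff Suc_le_eq)
  next
    fix m assume m: "m \<in> {1..(N - 1) div p}"
    hence "p * m \<le> N - 1" using assms by (simp add: less_eq_div_iff_mult_less_eq mult.commute)
    thus "p * m div p = m" "p * m \<in> {n \<in> {1..<N}. p dvd n}" using m assms
        by (cases N; auto simp: Suc_le_eq)+
  qed
  finally show ?thesis .
qed

text \<open>Comparison with the telescoping series of \<open>1 / ((n - 1) * n)\<close>.\<close>

lemma sum_inverse_squares_le: "finite P \<Longrightarrow> (\<And>p. p \<in> P \<Longrightarrow> p \<ge> 2) \<Longrightarrow> (\<Sum>p\<in>P. 1 / (real p)\<^sup>2) \<le> 1"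
proof -
  assume P: "finite P" "\<And>p. p \<in> P \<Longrightarrow> p \<ge> 2"
  have ind: "(\<Sum>n\<in>{2..<k+2}. 1 / (real n)\<^sup>2) \<le> 1 - 1 / (real k + 1)" for k
  proof (induction k)
    case (Suc k)
    have "(\<Sum>n\<in>{2..<Suc k+2}. 1 / (real n)\<^sup>2) = (\<Sum>n\<in>{2..<k+2}. 1 / (real n)\<^sup>2) + 1 / (real k + 2)\<^sup>2"
      by (simp add: add.commute)
    also have "\<dots> \<le> 1 - 1 / (real k + 1) + 1 / ((real k + 1) * (real k + 2))"
      by (intro add_mono Suc.IH frac_le) (auto simp: power2_eq_square)
    also have "\<dots> = 1 - 1 / (real (Suc k) + 1)" by (simp add: divide_simps) (simp add: algebra_simps)
    finally show ?case .
  qed simp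
  obtain k where k: "P \<subseteq> {..<k}" using P(1) finite_nat_iff_bounded by blast
  have "(\<Sum>p\<in>P. 1 / (real p)\<^sup>2) \<le> (\<Sum>n\<in>{2..<k+2}. 1 / (real n)\<^sup>2)"
    using k P by (intro sum_mono2) fastforce+
  also have "\<dots> \<le> 1" using ind[of k] by (smt (verit) divide_nonneg_nonneg of_nat_0_le_iff)
  finally show ?thesis .
qed

subsection \<open>A quantitative form of Katai's criterion\<close>

text \<open>
  All primes of one block have the same order of magnitude, so that Cauchy--Schwarz in \<open>m\<close>
  loses nothing for correlations that are merely small rather than \<open>o(N)\<close>.
\<close>
lemma Katai_block:
  fixes a b g :: "nat \<Rightarrow> complex" and P :: "nat set"
  assumes fin: "finite P" and y: "y > 0" and P: "\<And>p. p \<in> P \<Longrightarrow> y \<le> p"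
    and a: "\<And>n. norm (a n) \<le> 1" and b: "\<And>p. p \<in> P \<Longrightarrow> norm (b p) \<le> 1" and g: "\<And>m. m > 0 \<Longrightarrow> norm (g m)
        \<le> 1"
    and \<epsilon>: "\<epsilon> > 0"
    and bad: "\<And>p. p \<in> P \<Longrightarrow> card {q \<in> P. \<not> (\<forall>\<^sub>F K in sequentially. norm (\<Sum>m\<in>{1..K}. a (p * m)
        * cnj (a (q * m))) \<le> \<epsilon> * real K)} \<le> k"
  shows "\<forall>\<^sub>F N in sequentially. norm (\<Sum>p\<in>P. \<Sum>m\<in>{1..(N - 1) div p}. b p * g m * a (p * m))
           \<le> real N / real y * sqrt (\<epsilon> * (real (card P))\<^sup>2 + real k * real (card P))"
proof -
  define good where "good = (\<lambda>p q. \<forall>\<^sub>F K in sequentially. norm (\<Sum>m\<in>{1..K}. a (p * m)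
      * cnj (a (q * m))) \<le> \<epsilon> * real K)"
  have bad: "card {q \<in> P. \<not> good p q} \<le> k" if "p \<in> P" for p
    using bad[OF that] unfolding good_def .
  have pos: "p > 0" if "p \<in> P" for p using P[OF that] y by simp
  have "\<forall>\<^sub>F N in sequentially. good p q \<longrightarrow> norm (\<Sum>m\<in>{1..(N - 1) div max p q}. a (p * m)
      * cnj (a (q * m))) \<le> \<epsilon> * real ((N - 1) div max p q)"
    if "p \<in> P" "q \<in> P" for p q
  proof (cases "good p q")
    case True
    \<comment> \<open>For fixed \<open>p\<close> and \<open>q\<close> the length of the correlation
      sum grows with \<open>N\<close>, so the bound for good pairs becomes available.\<close>
    have "filterlim (\<lambda>N. (N - 1) div max p q) at_top sequentially"
      unfolding filterlim_at_top
    proof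
      fix Z
      show "\<forall>\<^sub>F N in sequentially. Z \<le> (N - 1) div max p q"
        using eventually_gt_at_top[of "Z * max p q"]
        by eventually_elim (use pos[OF that(1)] in \<open>auto simp: less_eq_div_iff_mult_less_eq\<close>)
    qed
    from eventually_compose_filterlim[OF True[unfolded good_def] this] show ?thesis
      by eventually_elim simp
  qed simp
  hence "\<forall>\<^sub>F N in sequentially. \<forall>p\<in>P. \<forall>q\<in>P. good p q \<longrightarrow> norm (\<Sum>m\<in>{1..(N - 1) div max p q}. a (p * m)
      * cnj (a (q * m))) \<le> \<epsilon> * real ((N - 1) div max p q)"
    using fin by (intro eventually_ball_finite ballI) auto
  thus ?thesis
  proof eventually_elim
    case (elim N)
    define L where "L = (N - 1) div y"
    \<comment> \<open>The indicator lets all \<open>p\<close> share the range \<open>{1..L}\<close>.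
      The factor \<open>g m\<close> is then free of \<open>p\<close> and is removed by
      Cauchy-Schwarz.\<close>
    define h where "h = (\<lambda>m. \<Sum>p\<in>P. of_bool (m \<le> (N - 1) div p) * (b p * a (p * m)))"
    have le_L: "(N - 1) div p \<le> L" if "p \<in> P" for p
      unfolding L_def using P[OF that] y by (rule div_le_mono2[rotated])
    have swap: "(\<Sum>p\<in>P. \<Sum>m\<in>{1..(N - 1) div p}. b p * g m * a (p * m)) = (\<Sum>m\<in>{1..L}. g m * h m)"
    proof -
      have "(\<Sum>p\<in>P. \<Sum>m\<in>{1..(N - 1) div p}. b p * g m * a (p * m))
          = (\<Sum>p\<in>P. \<Sum>m\<in>{1..L}. g m * (of_bool (m \<le> (N - 1) div p) * (b p * a (p * m))))"
        using le_L by (intro sum.cong refl sum.mono_neutral_cong_left) (auto intro: order_trans)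
      also have "\<dots> = (\<Sum>m\<in>{1..L}. \<Sum>p\<in>P. g m * (of_bool (m \<le> (N - 1) div p) * (b p * a (p * m))))"
        by (rule sum.swap)
      finally show ?thesis by (simp add: h_def sum_distrib_left)
    qed
    define corr where "corr = (\<lambda>p q. \<Sum>m\<in>{1..(N - 1) div max p q}. a (p * m) * cnj (a (q * m)))"
    have hh: "(\<Sum>m\<in>{1..L}. complex_of_real ((norm (h m))\<^sup>2)) = (\<Sum>p\<in>P. \<Sum>q\<in>P. b p * cnj (b q) * corr p
        q)"
    proof -
      have "(\<Sum>m\<in>{1..L}. complex_of_real ((norm (h m))\<^sup>2))
          = (\<Sum>m\<in>{1..L}. \<Sum>p\<in>P. \<Sum>q\<in>P. b p * cnj (b q) * (of_bool (m \<le> (N - 1) div p \<and> m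
              \<le> (N - 1) div q) * (a (p * m) * cnj (a (q * m)))))"
        unfolding complex_norm_square h_def cnj_sum sum_product
        by (intro sum.cong refl) auto
      also have "\<dots> = (\<Sum>p\<in>P. \<Sum>m\<in>{1..L}. \<Sum>q\<in>P. b p * cnj (b q) * (of_bool (m \<le> (N - 1) div p \<and> m
          \<le> (N - 1) div q) * (a (p * m) * cnj (a (q * m)))))"
        by (rule sum.swap)
      also have "\<dots> = (\<Sum>p\<in>P. \<Sum>q\<in>P. \<Sum>m\<in>{1..L}. b p * cnj (b q) * (of_bool (m \<le> (N - 1) div p \<and> m
          \<le> (N - 1) div q) * (a (p * m) * cnj (a (q * m)))))"
        by (intro sum.cong refl sum.swap)
      also have "\<dots> = (\<Sum>p\<in>P. \<Sum>q\<in>P. b p * cnj (b q) * corr p q)"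
      proof (intro sum.cong refl)
        fix p q assume pq: "p \<in> P" "q \<in> P"
        \<comment> \<open>Both indicators hold exactly up to the smaller quotient, which belongs to
          the larger prime.\<close>
        have "(N - 1) div max p q = min ((N - 1) div p) ((N - 1) div q)"
          using pos pq by (auto simp: max_def min_def dest: div_le_mono2[rotated, of _ _ "N - 1"]
              intro: le_antisym div_le_mono2)
        hence "corr p q = (\<Sum>m\<in>{1..L}. of_bool (m \<le> (N - 1) div p \<and> m \<le> (N - 1) div q) * (a (p * m)
            * cnj (a (q * m))))"
          unfolding corr_def using le_L[OF pq(1)]
          by (intro sum.mono_neutral_cong_left) (auto simp: min_le_iff_disj)
        thus "(\<Sum>m\<in>{1..L}. b p * cnj (b q) * (of_bool (m \<le> (N - 1) div p \<and> m \<le> (N - 1) div q)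
            * (a (p * m) * cnj (a (q * m)))))
            = b p * cnj (b q) * corr p q"
          by (simp only: sum_distrib_left)
      qed
      finally show ?thesis .
    qed
    \<comment> \<open>Bad pairs receive the trivial bound; their number per \<open>p\<close> is at
      most \<open>k\<close>.\<close>
    have corr_le: "norm (corr p q) \<le> \<epsilon> * real L + (if good p q then 0 else real L)" if pq: "p \<in> P"
        "q \<in> P" for p q
    proof -
      have max: "real ((N - 1) div max p q) \<le> real L" using le_L pq by (auto simp: max_def)
      show ?thesis
      proof (cases "good p q")
        case True
        hence "norm (corr p q) \<le> \<epsilon> * real ((N - 1) div max p q)" using elim pq
            by (auto simp: corr_def)
        also have "\<dots> \<le> \<epsilon> * real L" using max \<epsilon> by (intro mult_left_mono) auto
        finally show ?thesis using True by simp
      next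
        case False
        have "norm (corr p q) \<le> (\<Sum>m\<in>{1..(N - 1) div max p q}. 1)"
          unfolding corr_def using a
              by (intro sum_norm_le) (auto simp: norm_mult intro: mult_le_one)
        also have "\<dots> \<le> real L" using max by simp
        also have "\<dots> \<le> \<epsilon> * real L + real L" using \<epsilon> by simp
        finally show ?thesis using False by simp
      qed
    qed
    have "(\<Sum>m\<in>{1..L}. (norm (h m))\<^sup>2) = norm (\<Sum>p\<in>P. \<Sum>q\<in>P. b p * cnj (b q) * corr p q)"
      unfolding hh[symmetric] of_real_sum[symmetric] norm_of_real by (simp add: sum_nonneg)
    also have "\<dots> \<le> (\<Sum>p\<in>P. \<Sum>q\<in>P. \<epsilon> * real L + (if good p q then 0 else real L))"
    proof (intro sum_norm_le)
      fix p q assume pq: "p \<in> P" "q \<in> P"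
      have "norm (b p * cnj (b q) * corr p q) \<le> 1 * 1 * norm (corr p q)"
        unfolding norm_mult complex_mod_cnj using b pq by (intro mult_mono mult_nonneg_nonneg) auto
      also have "\<dots> \<le> \<epsilon> * real L + (if good p q then 0 else real L)" using corr_le pq by simp
      finally show "norm (b p * cnj (b q) * corr p q)
          \<le> \<epsilon> * real L + (if good p q then 0 else real L)" .
    qed
    also have "\<dots> = (\<Sum>p\<in>P. real (card P) * (\<epsilon> * real L) + real (card {q \<in> P. \<not> good p q}) * real L)"
    proof (intro sum.cong refl)
      fix p
      have "(\<Sum>q\<in>P. if good p q then 0 else real L) = (\<Sum>q\<in>{q \<in> P. \<not> good p q}. real L)"
        using fin by (intro sum.mono_neutral_cong_right) auto
      thus "(\<Sum>q\<in>P. \<epsilon> * real L + (if good p q then 0 else real L)) = real (card P) * (\<epsilon> * real L)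
          + real (card {q \<in> P. \<not> good p q}) * real L"
        by (simp add: sum.distrib)
    qed
    also have "\<dots> \<le> (\<Sum>p\<in>P. real (card P) * (\<epsilon> * real L) + real k * real L)"
      using bad by (intro sum_mono add_left_mono mult_right_mono) auto
    also have "\<dots> = real L * (\<epsilon> * (real (card P))\<^sup>2 + real k * real (card P))"
      by (simp add: algebra_simps power2_eq_square)
    finally have hsum: "(\<Sum>m\<in>{1..L}. (norm (h m))\<^sup>2) \<le> real L * (\<epsilon> * (real (card P))\<^sup>2 + real k
        * real (card P))" .
    have "norm (\<Sum>m\<in>{1..L}. g m * h m) \<le> (\<Sum>m\<in>{1..L}. 1 * norm (h m))"
      using g by (intro sum_norm_le) (auto simp: norm_mult intro!: mult_left_le_one_le)
    hence "(norm (\<Sum>m\<in>{1..L}. g m * h m))\<^sup>2 \<le> (\<Sum>m\<in>{1..L}. 1 * norm (h m))\<^sup>2"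
        by (intro power_mono) auto
    also have "\<dots> \<le> (\<Sum>m\<in>{1..L}. 1\<^sup>2) * (\<Sum>m\<in>{1..L}. (norm (h m))\<^sup>2)" by (rule Cauchy_Schwarz_ineq_sum)
    also have "\<dots> \<le> real L * (real L * (\<epsilon> * (real (card P))\<^sup>2 + real k * real (card P)))"
      using hsum by (simp add: mult_left_mono)
    also have "\<dots> = (real L * sqrt (\<epsilon> * (real (card P))\<^sup>2 + real k * real (card P)))\<^sup>2"
      using \<epsilon> by (simp add: power_mult_distrib power2_eq_square[of "real L"])
    finally have "norm (\<Sum>m\<in>{1..L}. g m * h m) \<le> real L * sqrt (\<epsilon> * (real (card P))\<^sup>2 + real k
        * real (card P))"
      by (rule power2_le_imp_le) (use \<epsilon> in simp)
    also have "\<dots> \<le> real N / real y * sqrt (\<epsilon> * (real (card P))\<^sup>2 + real k * real (card P))"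
    proof (intro mult_right_mono)
      have "real L \<le> real (N - 1) / real y" unfolding L_def by (rule of_nat_div_le_of_nat)
      also have "\<dots> \<le> real N / real y" by (intro divide_right_mono) auto
      finally show "real L \<le> real N / real y" .
    qed (use \<epsilon> in simp)
    finally show ?case unfolding swap .
  qed
qed

text \<open>The constant \<open>A J\<close> is replaced by the number of prime divisors of
  \<open>n\<close> from \<open>P\<close>, at the cost of the variance bound. Writing
  \<open>n = p * m\<close> and splitting \<open>f (p * m)\<close> gives a bilinear sum, which is
  estimated block by block. Good pairs contribute in proportion to the reciprocal sum of the block,
  bad pairs a geometric series in \<open>j\<close>.\<close>

lemma Katai_bound:
  fixes a f :: "nat \<Rightarrow> complex"
  assumes mult: "multiplicative f" and f: "\<And>n. n > 0 \<Longrightarrow> norm (f n) \<le> 1" and a: "\<And>n. norm (a n) \<le> 1"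
    and \<epsilon>: "\<epsilon> > 0"
    and bad: "\<And>p. prime p \<Longrightarrow> finite {q. prime q \<and> \<not> (\<forall>\<^sub>F K in sequentially. norm (\<Sum>m\<in>{1..K}. a
        (p * m) * cnj (a (q * m))) \<le> \<epsilon> * real K)} \<and>
        card {q. prime q \<and> \<not> (\<forall>\<^sub>F K in sequentially. norm (\<Sum>m\<in>{1..K}. a (p * m) * cnj (a (q * m)))
            \<le> \<epsilon> * real K)} \<le> k"
  defines "A \<equiv> \<lambda>J. \<Sum>p | prime p \<and> p < 4 ^ J. 1 / real p"
  shows "\<forall>\<^sub>F N in sequentially. A J * norm (\<Sum>n\<in>{1..<N}. f n * a n)
     \<le> real N * (4 * sqrt \<epsilon> * A J + 4 * sqrt (real k) + 2 + sqrt (2 * A J))"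
proof -
  define P where "P = {p::nat. prime p \<and> p < 4 ^ J}"
  define Q where "Q = (\<lambda>j. {p::nat. prime p \<and> 4 ^ j \<le> p \<and> p < 4 ^ Suc j})"
  have finP: "finite P" unfolding P_def by simp
  have finQ: "finite (Q j)" for j unfolding Q_def by simp
  have decomp: "(\<Sum>p\<in>P. F p) = (\<Sum>j<J. \<Sum>p\<in>Q j. F p)" for F :: "nat \<Rightarrow> 'b :: comm_monoid_add"
    unfolding P_def
  proof (induction J)
    case 0
    have eq: "{p::nat. prime p \<and> p < 4 ^ 0} = {}" using prime_gt_0_nat by auto
    show ?case unfolding eq by simp
  next
    case (Suc J)
    have "{p::nat. prime p \<and> p < 4 ^ Suc J} = {p. prime p \<and> p < 4 ^ J} \<union> Q J"
      by (auto simp: Q_def intro: less_le_trans[of _ "4 ^ J"])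
    moreover have "{p. prime p \<and> p < 4 ^ J} \<inter> Q J = {}" by (auto simp: Q_def)
    ultimately show ?case using Suc.IH finQ[of J] by (simp add: sum.union_disjoint)
  qed
  have A: "A J = (\<Sum>p\<in>P. 1 / real p)" by (simp add: A_def P_def)
  have A0: "A J \<ge> 0" unfolding A by (simp add: sum_nonneg)
  define AQ where "AQ = (\<lambda>j. \<Sum>p\<in>Q j. 1 / real p)"
  have A_AQ: "A J = (\<Sum>j<J. AQ j)" unfolding A AQ_def by (rule decomp)
  have blocks: "\<forall>\<^sub>F N in sequentially. norm (\<Sum>p\<in>Q j. \<Sum>m\<in>{1..(N - 1) div p}. f p * f m * a (p * m))
      \<le> real N * (4 * sqrt \<epsilon> * AQ j + 2 * sqrt (real k) * (1/2) ^ j)" for j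
  proof -
    have "\<forall>\<^sub>F N in sequentially. norm (\<Sum>p\<in>Q j. \<Sum>m\<in>{1..(N - 1) div p}. f p * f m * a (p * m))
           \<le> real N / real (4 ^ j) * sqrt (\<epsilon> * (real (card (Q j)))\<^sup>2 + real k * real (card (Q j)))"
    proof (rule Katai_block[OF finQ _ _ a _ _ \<epsilon>])
      fix p assume p: "p \<in> Q j"
      thus "norm (f p) \<le> 1" by (intro f) (auto simp: Q_def prime_gt_0_nat)
      have "prime p" using p by (simp add: Q_def)
      note B = bad[OF this]
      show "card {q \<in> Q j. \<not> (\<forall>\<^sub>F K in sequentially. norm (\<Sum>m\<in>{1..K}. a (p * m) * cnj (a (q * m)))
          \<le> \<epsilon> * real K)} \<le> k"
        by (rule order_trans[OF card_mono conjunct2[OF B]]) (use B in \<open>auto simp: Q_def\<close>)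
    qed (auto simp: Q_def f)
    thus ?thesis
    proof eventually_elim
      case (elim N)
      define C where "C = real (card (Q j))"
      \<comment> \<open>Primes of a block are below \<open>4 * 4 ^ j\<close>, so its cardinality
        over \<open>4 ^ j\<close> is at most four times its reciprocal sum.\<close>
      have "(\<Sum>p\<in>Q j. 1 / (4 * 4 ^ j)) \<le> AQ j"
        unfolding AQ_def
      proof (intro sum_mono)
        fix p assume "p \<in> Q j"
        hence "0 < p" "p < 4 * 4 ^ j" by (auto simp: Q_def prime_gt_0_nat)
        hence "real p \<le> real (4 * 4 ^ j)" by (simp only: of_nat_le_iff)
        thus "1 / (4 * 4 ^ j) \<le> 1 / real p" using \<open>0 < p\<close> by (intro divide_left_mono) auto
      qed
      hence C1: "C / 4 ^ j \<le> 4 * AQ j" by (simp add: C_def field_simps)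
      \<comment> \<open>The square root of the cardinality is at most \<open>2 * 2 ^ j\<close>;
        against the denominator \<open>4 ^ j\<close> this leaves the decay \<open>(1/2) ^ j\<close>
        for bad pairs.\<close>
      have "card (Q j) \<le> card {..<4 * 4 ^ j :: nat}" by (intro card_mono) (auto simp: Q_def)
      hence "card (Q j) \<le> 4 * 4 ^ j" by simp
      hence "real (card (Q j)) \<le> real (4 * 4 ^ j)" by (simp only: of_nat_le_iff)
      hence C2: "C \<le> (2 * 2 ^ j)\<^sup>2"
          by (simp add: C_def power_mult_distrib power2_eq_square flip: power_mult_distrib)
      have "sqrt (\<epsilon> * C\<^sup>2 + real k * C) \<le> sqrt (\<epsilon> * C\<^sup>2) + sqrt (real k * C)"
        using \<epsilon> by (intro sqrt_add_le_add_sqrt) (auto simp: C_def)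
      also have "\<dots> = sqrt \<epsilon> * C + sqrt (real k) * sqrt C" by (simp add: real_sqrt_mult C_def)
      also have "\<dots> \<le> sqrt \<epsilon> * C + sqrt (real k) * (2 * 2 ^ j)"
        by (intro add_left_mono mult_left_mono real_le_lsqrt C2) auto
      finally have "sqrt (\<epsilon> * C\<^sup>2 + real k * C) / 4 ^ j \<le> (sqrt \<epsilon> * C + sqrt (real k) * (2 * 2 ^ j))
          / 4 ^ j"
        by (intro divide_right_mono) auto
      also have "\<dots> = sqrt \<epsilon> * (C / 4 ^ j) + 2 * sqrt (real k) * (1/2) ^ j"
      proof -
        have "(4::real) ^ j = 2 ^ j * 2 ^ j" by (simp flip: power_mult_distrib)
        thus ?thesis by (simp add: field_simps power_divide)
      qed
      also have "\<dots> \<le> sqrt \<epsilon> * (4 * AQ j) + 2 * sqrt (real k) * (1/2) ^ j"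
        using C1 \<epsilon> by (intro add_right_mono mult_left_mono) auto
      finally have "real N * (sqrt (\<epsilon> * C\<^sup>2 + real k * C) / 4 ^ j) \<le> real N * (sqrt \<epsilon> * (4 * AQ j)
          + 2 * sqrt (real k) * (1/2) ^ j)"
        by (intro mult_left_mono) auto
      with elim show ?case by (simp add: C_def mult_ac)
    qed
  qed
  have "\<forall>\<^sub>F N in sequentially. \<forall>j\<in>{..<J}. norm (\<Sum>p\<in>Q j. \<Sum>m\<in>{1..(N - 1) div p}. f p * f m
      * a (p * m))
      \<le> real N * (4 * sqrt \<epsilon> * AQ j + 2 * sqrt (real k) * (1/2) ^ j)"
    using blocks by (intro eventually_ball_finite) auto
  \<comment> \<open>For \<open>N \<ge> 2 * card P\<close> the rounding term of the variance bound is
    at most \<open>A J * N\<close>.\<close>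
  thus ?thesis using eventually_ge_at_top[of "2 * card P"]
  proof eventually_elim
    case (elim N)
    define S where "S = (\<Sum>n\<in>{1..<N}. f n * a n)"
    define \<omega> where "\<omega> = (\<lambda>n::nat. \<Sum>p\<in>P. of_bool (p dvd n) :: real)"
    define M where "M = (\<Sum>p\<in>P. \<Sum>m\<in>{1..(N - 1) div p}. f p * f m * a (p * m))"
    have "norm M \<le> (\<Sum>j<J. real N * (4 * sqrt \<epsilon> * AQ j + 2 * sqrt (real k) * (1/2) ^ j))"
      unfolding M_def decomp using elim(1) by (intro sum_norm_le) auto
    also have "\<dots> = real N * (4 * sqrt \<epsilon> * A J + 2 * sqrt (real k) * (\<Sum>j<J. (1/2) ^ j))"
      by (simp add: A_AQ sum.distrib flip: sum_distrib_left)
    also have "(\<Sum>j<J. (1/2::real) ^ j) = 2 - 2 * (1/2) ^ J" by (induction J) auto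
    also have "\<dots> \<le> 2" by simp
    finally have M: "norm M \<le> real N * (4 * sqrt \<epsilon> * A J + 4 * sqrt (real k))"
      by (simp add: mult_left_mono)
    have pos: "p > 0" if "p \<in> P" for p using that by (auto simp: P_def prime_gt_0_nat)
    have "(\<Sum>n\<in>{1..<N}. f n * a n * of_real (\<omega> n)) = (\<Sum>n\<in>{1..<N}. \<Sum>p\<in>P. f n * a n
        * of_bool (p dvd n))"
      unfolding \<omega>_def of_real_sum sum_distrib_left by (intro sum.cong refl) (simp add: of_bool_def)
    also have "\<dots> = (\<Sum>p\<in>P. \<Sum>n\<in>{1..<N}. f n * a n * of_bool (p dvd n))" by (rule sum.swap)
    also have "\<dots> = (\<Sum>p\<in>P. \<Sum>m\<in>{1..(N - 1) div p}. f (p * m) * a (p * m))"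
      by (intro sum.cong refl sum_multiples pos)
    finally have om: "(\<Sum>n\<in>{1..<N}. f n * a n * of_real (\<omega> n))
        = (\<Sum>p\<in>P. \<Sum>m\<in>{1..(N - 1) div p}. f (p * m) * a (p * m))" .
    have "norm ((\<Sum>n\<in>{1..<N}. f n * a n * of_real (\<omega> n)) - M) \<le> (\<Sum>p\<in>P. 2 * (real N / (real p)\<^sup>2))"
      unfolding om M_def sum_subtractf[symmetric]
    proof (intro sum_norm_le)
      fix p assume p: "p \<in> P"
      hence prime: "prime p" by (simp add: P_def)
      have "norm (\<Sum>m\<in>{1..(N - 1) div p}. f (p * m) * a (p * m) - f p * f m * a (p * m))
          \<le> (\<Sum>m\<in>{1..(N - 1) div p}. 2 * of_bool (p dvd m))"
      proof (intro sum_norm_le)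
        fix m assume "m \<in> {1..(N - 1) div p}"
        hence m: "m > 0" by simp
        show "norm (f (p * m) * a (p * m) - f p * f m * a (p * m)) \<le> 2 * of_bool (p dvd m)"
        proof (cases "p dvd m")
          case False
          hence "coprime p m" using prime by (simp add: prime_imp_coprime)
          hence "f (p * m) = f p * f m" using mult m pos[OF p] unfolding multiplicative_def by blast
          thus ?thesis by simp
        next
          case True
          have "norm (f (p * m) * a (p * m)) \<le> 1" "norm (f p * f m * a (p * m)) \<le> 1"
            using f m pos[OF p] a by (auto simp: norm_mult intro!: mult_le_one)
          thus ?thesis using True norm_triangle_ineq4[of "f (p * m) * a (p * m)" "f p * f m
              * a (p * m)"] by simp
        qed
      qed
      \<comment> \<open>Multiplicativity can fail only for \<open>p dvd m\<close>, that is, when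
        \<open>p * p\<close> divides \<open>n = p * m\<close>. This turns the error into a count of
        multiples of \<open>p * p\<close>.\<close>
      also have "\<dots> = 2 * (\<Sum>m\<in>{1..(N - 1) div p}. of_bool (p * p dvd p * m))"
        using pos[OF p] by (simp add: sum_distrib_left)
      also have "(\<Sum>m\<in>{1..(N - 1) div p}. of_bool (p * p dvd p * m) :: real)
          = (\<Sum>n\<in>{1..<N}. of_bool (p * p dvd n) * of_bool (p dvd n))"
        by (rule sum_multiples[OF pos[OF p], symmetric])
      also have "\<dots> \<le> (\<Sum>n\<in>{1..<N}. of_bool (p * p dvd n))" by (intro sum_mono) auto
      also have "\<dots> = real (card {n \<in> {1..<N}. p * p dvd n})"
        by (simp add: of_bool_def sum.If_cases Int_def)
      also have "\<dots> \<le> real N / real (p * p)" using pos[OF p] by (intro card_multiples_le) auto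
      finally show "norm (\<Sum>m\<in>{1..(N - 1) div p}. f (p * m) * a (p * m) - f p * f m * a (p * m))
          \<le> 2 * (real N / (real p)\<^sup>2)"
        by (simp add: power2_eq_square)
    qed
    also have "\<dots> = 2 * real N * (\<Sum>p\<in>P. 1 / (real p)\<^sup>2)" by (simp add: sum_distrib_left)
    also have "\<dots> \<le> 2 * real N * 1"
      by (intro mult_left_mono sum_inverse_squares_le finP) (auto simp: P_def prime_ge_2_nat)
    finally have E1: "norm ((\<Sum>n\<in>{1..<N}. f n * a n * of_real (\<omega> n)) - M) \<le> 2 * real N" by simp
    have E2: "norm (\<Sum>n\<in>{1..<N}. f n * a n * of_real (\<omega> n - A J)) \<le> real N * sqrt (2 * A J)"
    proof -
      have "norm (\<Sum>n\<in>{1..<N}. f n * a n * of_real (\<omega> n - A J)) \<le> (\<Sum>n\<in>{1..<N}. 1 * \<bar>\<omega> n - A J\<bar>)"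
      proof (intro sum_norm_le)
        fix n assume "n \<in> {1..<N}"
        hence "norm (f n * a n) \<le> 1" using f a by (auto simp: norm_mult intro!: mult_le_one)
        thus "norm (f n * a n * of_real (\<omega> n - A J)) \<le> 1 * \<bar>\<omega> n - A J\<bar>"
          unfolding norm_mult[of "f n * a n"] norm_of_real by (intro mult_right_mono) auto
      qed
      hence "(norm (\<Sum>n\<in>{1..<N}. f n * a n * of_real (\<omega> n - A J)))\<^sup>2
          \<le> (\<Sum>n\<in>{1..<N}. 1 * \<bar>\<omega> n - A J\<bar>)\<^sup>2"
        by (intro power_mono) auto
      also have "\<dots> \<le> (\<Sum>n\<in>{1..<N}. 1\<^sup>2) * (\<Sum>n\<in>{1..<N}. \<bar>\<omega> n - A J\<bar>\<^sup>2)"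
          by (rule Cauchy_Schwarz_ineq_sum)
      also have "\<dots> \<le> real N * (A J * real N + 2 * A J * real (card P))"
      proof (intro mult_mono)
        show "(\<Sum>n\<in>{1..<N}. \<bar>\<omega> n - A J\<bar>\<^sup>2) \<le> A J * real N + 2 * A J * real (card P)"
          using Turan_Kubilius[OF finP, of N] unfolding \<omega>_def A power2_abs by (simp add: P_def)
      qed (auto simp: sum_nonneg)
      also have "\<dots> \<le> real N * (A J * real N + A J * real N)"
      proof -
        have "A J * real (2 * card P) \<le> A J * real N" using elim(2) A0
            by (intro mult_left_mono) (simp_all only: of_nat_le_iff)
        thus ?thesis by (intro mult_left_mono) auto
      qed
      also have "\<dots> = (real N * sqrt (2 * A J))\<^sup>2"
        using A0 by (simp add: power_mult_distrib power2_eq_square[of "real N"])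
      finally show ?thesis by (rule power2_le_imp_le) (use A0 in simp)
    qed
    have "A J * norm S = norm (of_real (A J) * S)" using A0 by (simp add: norm_mult)
    also have "of_real (A J) * S = M + ((\<Sum>n\<in>{1..<N}. f n * a n * of_real (\<omega> n)) - M)
        - (\<Sum>n\<in>{1..<N}. f n * a n * of_real (\<omega> n - A J))"
      by (simp add: S_def right_diff_distrib sum_subtractf sum_distrib_left mult_ac)
    also have "norm \<dots> \<le> norm M + norm ((\<Sum>n\<in>{1..<N}. f n * a n * of_real (\<omega> n)) - M)
        + norm (\<Sum>n\<in>{1..<N}. f n * a n * of_real (\<omega> n - A J))"
      by (rule order_trans[OF norm_triangle_ineq4 add_right_mono[OF norm_triangle_ineq]])
    also have "\<dots> \<le> real N * (4 * sqrt \<epsilon> * A J + 4 * sqrt (real k)) + 2 * real N + real N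
        * sqrt (2 * A J)"
      by (intro add_mono M E1 E2)
    finally show ?case by (simp add: S_def algebra_simps)
  qed
qed

text \<open>After division by \<open>A J\<close> only the term \<open>4 * sqrt \<epsilon>\<close>
  does not decay. So \<epsilon> is fixed first, which fixes \<open>k\<close>, and then
  \<open>A J\<close> is made large by the divergence of the prime reciprocals.\<close>

lemma Katai_criterion:
  fixes a f :: "nat \<Rightarrow> complex"
  assumes mult: "multiplicative f" and f: "\<And>n. n > 0 \<Longrightarrow> norm (f n) \<le> 1" and a: "\<And>n. norm (a n) \<le> 1"
    and bad: "\<And>\<epsilon>. \<epsilon> > 0 \<Longrightarrow> \<exists>k. \<forall>p. prime p \<longrightarrow>
        finite {q. prime q \<and> \<not> (\<forall>\<^sub>F K in sequentially. norm (\<Sum>m\<in>{1..K}. a (p * m) * cnj (a (q * m)))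
            \<le> \<epsilon> * real K)} \<and>
        card {q. prime q \<and> \<not> (\<forall>\<^sub>F K in sequentially. norm (\<Sum>m\<in>{1..K}. a (p * m) * cnj (a (q * m)))
            \<le> \<epsilon> * real K)} \<le> k"
  shows "(\<lambda>N. norm (\<Sum>n\<in>{1..<N}. f n * a n) / real N) \<longlonglongrightarrow> 0"
proof (rule tendstoI)
  fix \<eta> :: real assume \<eta>: "\<eta> > 0"
  define \<epsilon> where "\<epsilon> = (\<eta> / 16)\<^sup>2"
  have \<epsilon>: "\<epsilon> > 0" using \<eta> by (simp add: \<epsilon>_def)
  obtain k where k: "\<And>p. prime p \<Longrightarrow>
        finite {q. prime q \<and> \<not> (\<forall>\<^sub>F K in sequentially. norm (\<Sum>m\<in>{1..K}. a (p * m) * cnj (a (q * m)))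
            \<le> \<epsilon> * real K)} \<and>
        card {q. prime q \<and> \<not> (\<forall>\<^sub>F K in sequentially. norm (\<Sum>m\<in>{1..K}. a (p * m) * cnj (a (q * m)))
            \<le> \<epsilon> * real K)} \<le> k"
    using bad[OF \<epsilon>] by blast
  define C where "C = 4 * sqrt (real k) + 2"
  define A where "A = (\<lambda>J. \<Sum>p | prime p \<and> p < 4 ^ J. 1 / real p)"
  \<comment> \<open>The first bound absorbs the constants \<open>C\<close>, the second makes
    \<open>sqrt (2 * A n)\<close> small against \<open>A n\<close>. Each is then at most
    \<open>A n * \<eta> / 4\<close>, as is the term with
    \<open>sqrt \<epsilon> = \<eta> / 16\<close>.\<close>
  obtain n where n: "max (4 * C / \<eta>) (32 / \<eta>\<^sup>2) < (\<Sum>p | prime p \<and> p < n. 1 / real p)"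
    using prime_reciprocals_unbounded by blast
  have le: "n \<le> 4 ^ n" by (rule less_imp_le, rule power_gt_expt) simp
  have "(\<Sum>p | prime p \<and> p < n. 1 / real p) \<le> A n"
    unfolding A_def by (intro sum_mono2) (auto intro: less_le_trans[OF _ le])
  hence An: "4 * C / \<eta> < A n" "32 / \<eta>\<^sup>2 < A n" using n by auto
  have An0: "A n > 0" using An(2) \<eta> by (smt (verit) divide_pos_pos zero_less_power)
  have C1: "C \<le> A n * (\<eta> / 4)" using An(1) \<eta> by (simp add: field_simps)
  have "2 * A n \<le> (A n * (\<eta> / 4))\<^sup>2"
    using An(2) \<eta> An0 by (simp add: field_simps power2_eq_square)
  hence C2: "sqrt (2 * A n) \<le> A n * (\<eta> / 4)" using An0 \<eta> by (intro real_le_lsqrt) auto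
  have C3: "sqrt \<epsilon> = \<eta> / 16" using \<eta> by (simp add: \<epsilon>_def)
  have "\<forall>\<^sub>F N in sequentially. A n * norm (\<Sum>n\<in>{1..<N}. f n * a n)
     \<le> real N * (4 * sqrt \<epsilon> * A n + 4 * sqrt (real k) + 2 + sqrt (2 * A n))"
    unfolding A_def by (rule Katai_bound[OF mult f a \<epsilon> k])
  thus "\<forall>\<^sub>F N in sequentially. dist (norm (\<Sum>n\<in>{1..<N}. f n * a n) / real N) 0 < \<eta>"
    using eventually_gt_at_top[of 0]
  proof eventually_elim
    case (elim N)
    have "4 * sqrt \<epsilon> * A n + 4 * sqrt (real k) + 2 + sqrt (2 * A n) \<le> A n * (3 * \<eta> / 4)"
      using C1 C2 unfolding C3 C_def by (simp add: algebra_simps)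
    hence "real N * (4 * sqrt \<epsilon> * A n + 4 * sqrt (real k) + 2 + sqrt (2 * A n))
        \<le> real N * (A n * (3 * \<eta> / 4))"
      by (intro mult_left_mono) auto
    with elim(1) have "A n * norm (\<Sum>n\<in>{1..<N}. f n * a n) \<le> real N * (A n * (3 * \<eta> / 4))"
      by linarith
    also have "\<dots> = A n * (real N * (3 * \<eta> / 4))" by simp
    finally have "A n * norm (\<Sum>n\<in>{1..<N}. f n * a n) \<le> A n * (real N * (3 * \<eta> / 4))" .
    hence "norm (\<Sum>n\<in>{1..<N}. f n * a n) \<le> real N * (3 * \<eta> / 4)" using An0 by simp
    also have "\<dots> < real N * \<eta>" using elim(2) \<eta> by simp
    finally show ?case using elim(2) by (simp add: field_simps)
  qed
qed

subsection \<open>The theorem\<close>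

text \<open>For fixed \<open>p\<close>, a bad \<open>q\<close> has its ratio of powers in the finite
  set \<open>B\<close>. The ratio determines \<open>q\<close>, so \<open>card B\<close> bounds the
  number of bad partners for all \<open>p\<close> at once.\<close>

lemma floor_powr_bad_primes:
  assumes c: "c > 0" "c \<notin> \<int>" and \<alpha>: "\<alpha> \<notin> \<int>" and \<epsilon>: "\<epsilon> > 0"
  defines "a \<equiv> \<lambda>n::nat. e (\<alpha> * of_int \<lfloor>real n powr c\<rfloor>)"
  shows "\<exists>k. \<forall>p. prime p \<longrightarrow>
    finite {q. prime q \<and> \<not> (\<forall>\<^sub>F K in sequentially. norm (\<Sum>m\<in>{1..K}. a (p * m) * cnj (a (q * m)))
        \<le> \<epsilon> * real K)} \<and>
    card {q. prime q \<and> \<not> (\<forall>\<^sub>F K in sequentially. norm (\<Sum>m\<in>{1..K}. a (p * m) * cnj (a (q * m)))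
        \<le> \<epsilon> * real K)} \<le> k"
proof -
  have "\<epsilon> / 4 > 0" using \<epsilon> by simp
  from floor_correlation_small[OF c \<alpha> this] obtain B where B: "finite B" and
    corr: "\<And>P Q. P > 0 \<Longrightarrow> Q > 0 \<Longrightarrow> Q / P \<notin> B \<Longrightarrow> \<forall>\<^sub>F N in sequentially.
      norm (\<Sum>n<N. e (\<alpha> * of_int \<lfloor>P * real n powr c\<rfloor>) * cnj (e (\<alpha> * of_int \<lfloor>Q * real n powr c\<rfloor>)))
          \<le> \<epsilon> / 4 * real N"
    by blast
  have a: "a (p * n) = e (\<alpha> * of_int \<lfloor>real p powr c * real n powr c\<rfloor>)" for p n
    by (simp add: a_def powr_mult)
  have good: "\<forall>\<^sub>F K in sequentially. norm (\<Sum>m\<in>{1..K}. a (p * m) * cnj (a (q * m))) \<le> \<epsilon> * real K"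
    if p: "prime p" and q: "prime q" and pq: "real q powr c / real p powr c \<notin> B" for p q
  proof -
    have "\<forall>\<^sub>F N in sequentially. norm (\<Sum>n<N. a (p * n) * cnj (a (q * n))) \<le> \<epsilon> / 4 * real N"
      unfolding a using p q pq by (intro corr) (auto simp: prime_gt_0_nat)
    \<comment> \<open>The correlation estimate includes \<open>n = 0\<close>, whose term has norm
      \<open>1\<close>. Starting from \<open>\<epsilon> / 4\<close> leaves room for that term and
      for the extra unit of length.\<close>
    hence ev: "\<forall>\<^sub>F K in sequentially. norm (\<Sum>n<Suc K. a (p * n) * cnj (a (q * n)))
        \<le> \<epsilon> / 4 * real (Suc K)"
      by (rule eventually_compose_filterlim) (rule filterlim_Suc)
    obtain K0 :: nat where K0: "real K0 > 2 / \<epsilon>" using reals_Archimedean2 by blast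
    show ?thesis using ev eventually_ge_at_top[of "max 1 K0"]
    proof eventually_elim
      case (elim K)
      have "2 / \<epsilon> < real K" "1 \<le> real K" using K0 elim by auto
      hence 1: "1 \<le> \<epsilon> / 2 * real K" "\<epsilon> / 4 * real (Suc K) \<le> \<epsilon> / 2 * real K" using \<epsilon>
          by (auto simp: field_simps)
      have "{..<Suc K} = insert 0 {1..K}" by auto
      hence "(\<Sum>n<Suc K. a (p * n) * cnj (a (q * n))) = (\<Sum>m\<in>{1..K}. a (p * m) * cnj (a (q * m)))
          + a 0 * cnj (a 0)"
        by (simp add: add.commute)
      hence "norm (\<Sum>m\<in>{1..K}. a (p * m) * cnj (a (q * m)))
          \<le> norm (\<Sum>n<Suc K. a (p * n) * cnj (a (q * n))) + norm (a 0 * cnj (a 0))"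
        by (metis add_diff_cancel_right' norm_triangle_ineq4)
      also have "norm (a 0 * cnj (a 0)) = 1" by (simp add: a_def norm_mult)
      finally show ?case using elim 1 by linarith
    qed
  qed
  show ?thesis
  proof (intro exI[of _ "card B"] allI impI)
    fix p :: nat assume p: "prime p"
    let ?X = "{q. prime q \<and> \<not> (\<forall>\<^sub>F K in sequentially. norm (\<Sum>m\<in>{1..K}. a (p * m) * cnj (a (q * m)))
        \<le> \<epsilon> * real K)}"
    let ?h = "\<lambda>q. real q powr c / real p powr c"
    have "inj_on ?h ?X"
    proof (rule inj_onI)
      fix q r assume qr: "?h q = ?h r"
      hence "real q powr c = real r powr c" using p by (simp add: prime_gt_0_nat)
      hence "(real q powr c) powr (1 / c) = (real r powr c) powr (1 / c)" by simp
      thus "q = r" using c by (simp add: powr_powr)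
    qed
    moreover have "?h ` ?X \<subseteq> B" using good[OF p] by blast
    ultimately show "finite ?X \<and> card ?X \<le> card B"
      using B by (auto intro: inj_on_finite card_inj_on_le)
  qed
qed

theorem theorem8:
  fixes c :: real
  assumes "c > 1" and "c \<notin> \<int>"
  shows "\<forall>(f :: nat \<Rightarrow> complex) (\<alpha> :: real).
           multiplicative f \<longrightarrow> (\<forall>n>0. norm (f n) \<le> 1) \<longrightarrow>
           \<alpha> \<in> \<rat> \<longrightarrow> \<alpha> \<notin> \<int> \<longrightarrow>
           ((\<lambda>N. norm (\<Sum>n\<in>{1..<N}. f n * e (\<alpha> * of_int \<lfloor>real n powr c\<rfloor>)) / real N)
              \<longlongrightarrow> 0) sequentially"
proof (intro allI impI)
  fix f :: "nat \<Rightarrow> complex" and \<alpha> :: real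
  assume f: "multiplicative f" "\<forall>n>0. norm (f n) \<le> 1" and \<alpha>: "\<alpha> \<notin> \<int>"
  show "(\<lambda>N. norm (\<Sum>n\<in>{1..<N}. f n * e (\<alpha> * of_int \<lfloor>real n powr c\<rfloor>)) / real N) \<longlonglongrightarrow> 0"
    using f(2) assms \<alpha> by (intro Katai_criterion f(1) floor_powr_bad_primes) auto
qed

end
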